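(* Let $r\ge 2$, let $\mathbb{F}=\langle a_1,\dots,a_r\rangle$ be the free group of rank $r$, and let $(X,\mathcal{B},\lambda)$ be a standard $\sigma$-finite measure space on which $\mathbb{F}$ acts by non-singular transformations. Let $u,v\in L^1(X\times\partial\mathbb{F},\lambda\times\nu)$ with $v>0$. Then the ratios $$\mathrm{RATIO}_{2n}[u,v](x,\xi):=\frac{\sum_{g\in H_\xi,\ |g|\le 2n}\widehat{T}^g u(x,\xi)}{\sum_{g\in H_\xi,\ |g|\le 2n}\widehat{T}^g v(x,\xi)}$$ converge pointwise $\lambda\times\nu$-almost everywhere as $n\to\infty$ to an $\mathcal{R}_0(X)$-invariant function $r(u,v)$. If $\mathcal{R}_0(X)$ is ergodic, then $r(u,v)$ equals the constant $\frac{\int u\,d(\lambda\times\nu)}{\int v\,d(\lambda\times\nu)}$ almost everywhere.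
   Context: Let $S=\{a_1^{\pm1},\dots,a_r^{\pm1}\}$. For $g\in\mathbb{F}$, $|g|$ is the length of the reduced form of $g$ in the letters $S$. Boundary: $\partial\mathbb{F}$ is the set of sequences $\xi=(\xi_1,\xi_2,\dots)\in S^{\mathbb{N}}$ with $\xi_{i+1}\ne\xi_i^{-1}$ for all $i\ge1$. It carries the Borel probability measure $\nu$ determined by $\nu(\{\xi:\xi_i=s_i,\ 1\le i\le n\})=(2r)^{-1}(2r-1)^{-(n-1)}$ for every $(s_1,\dots,s_n)\in S^n$ with $s_{i+1}\ne s_i^{-1}$ for all $i$. $\mathbb{F}$ acts on $\partial\mathbb{F}$ by $(t_1\cdots t_n)\xi=(t_1,\dots,t_{n-k},\xi_{k+1},\xi_{k+2},\dots)$, where $t_1\cdots t_n$ is in reduced form and $k\le n$ is the largest number such that $\xi_i^{-1}=t_{n+1-i}$ for all $i\le k$. This action preserves the measure class of $\nu$, and with $g=t_1\cdots t_n$ one has $\frac{d\nu\circ g}{d\nu}(\xi)=(2r-1)^{2k-n}$. Horosphere: $H_\xi=\{g\in\mathbb{F}:\frac{d\nu\circ g^{-1}}{d\nu}(\xi)=1\}$ (using the formula above for the derivative). $\mathbb{F}$ acts diagonally on $X\times\partial\mathbb{F}$, non-singularly with respect to $\lambda\times\nu$, and on $L^1(X\times\partial\mathbb{F})$ by the isometries $$\widehat{T}^g u(x,\xi)=u(g^{-1}x,g^{-1}\xi)\,\frac{d\,g_*(\lambda\times\nu)}{d(\lambda\times\nu)}(x,\xi).$$ $\mathcal{R}_0(X)$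 is the equivalence relation on $X\times\partial\mathbb{F}$ under which $(x,\xi)\sim(y,\xi')$ iff there is $g\in H_\xi$ with $(y,\xi')=(g^{-1}x,g^{-1}\xi)$. A function is $\mathcal{R}_0(X)$-invariant if it is constant on equivalence classes (up to a null set). $\mathcal{R}_0(X)$ is ergodic if every $\mathcal{R}_0(X)$-invariant measurable set is $\lambda\times\nu$-null or conull. *)

theory Defs
  imports "HOL-Probability.Probability" "HOL-Algebra.Group_Action"
begin

subsection \<open>The free group of rank \<open>r\<close>\<close>

text \<open>The letter \<open>(i, True)\<close> stands for the generator \<open>a\<^sub>i\<close> and \<open>(i, False)\<close> for its inverse.\<close>

type_synonym letter = "nat \<times> bool"

definition letters :: "nat \<Rightarrow> letter set"
  where "letters r = {..<r} \<times> UNIV"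

definition inv_letter :: "letter \<Rightarrow> letter"
  where "inv_letter s = (fst s, \<not> snd s)"

definition is_reduced :: "letter list \<Rightarrow> bool"
  where "is_reduced w \<longleftrightarrow> successively (\<lambda>x y. y \<noteq> inv_letter x) w"

definition reduced_words :: "nat \<Rightarrow> letter list set"
  where "reduced_words r = {w \<in> lists (letters r). is_reduced w}"

fun cons_red :: "letter \<Rightarrow> letter list \<Rightarrow> letter list"
  where
    "cons_red x [] = [x]"
  | "cons_red x (y # ys) = (if y = inv_letter x then ys else x # y # ys)"

definition reduced_form :: "letter list \<Rightarrow> letter list"
  where "reduced_form w = foldr cons_red w []"

text \<open>A group element is its own reduced form, so that its word length is \<^const>\<open>length\<close>.\<close>

definition free_grp :: "nat \<Rightarrow> letter list monoid"
  where "free_grp r =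
    \<lparr>carrier = reduced_words r, mult = (\<lambda>v w. reduced_form (v @ w)), one = []\<rparr>"

lemma inv_letter_inv_letter [simp]: "inv_letter (inv_letter x) = x"
  by (simp add: inv_letter_def)

lemma inv_letter_in_letters [simp]: "inv_letter x \<in> letters r \<longleftrightarrow> x \<in> letters r"
  by (cases x) (auto simp: inv_letter_def letters_def)

lemma inv_letter_eq_iff: "inv_letter x = y \<longleftrightarrow> x = inv_letter y"
  by (auto simp: inv_letter_def prod_eq_iff)

lemma is_reduced_Nil [simp]: "is_reduced []"
  by (simp add: is_reduced_def)

lemma cons_red_reduced: "is_reduced w \<Longrightarrow> is_reduced (cons_red x w)"
  by (cases w; cases "tl w") (auto simp: is_reduced_def successively_Cons)

lemma cons_red_cancel:
  assumes "is_reduced w" shows "cons_red (inv_letter x) (cons_red x w) = w"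
proof (cases w)
  case Nil
  then show ?thesis by simp
next
  case (Cons y ys)
  then show ?thesis using assms
    by (cases ys) (auto simp: is_reduced_def)
qed

lemma foldr_cons_red_reduced: "is_reduced w \<Longrightarrow> is_reduced (foldr cons_red v w)"
  by (induction v) (auto simp: cons_red_reduced)

lemma reduced_form_reduced: "is_reduced (reduced_form w)"
  unfolding reduced_form_def by (rule foldr_cons_red_reduced) (simp add: is_reduced_def)

lemma reduced_form_id: "is_reduced w \<Longrightarrow> reduced_form w = w"
proof (induction w)
  case Nil
  then show ?case by (simp add: reduced_form_def)
next
  case (Cons x w)
  then show ?case
    by (cases w) (auto simp: reduced_form_def is_reduced_def)
qed

lemma foldr_cons_red_cons_red:
  assumes "is_reduced w"
  shows "foldr cons_red (cons_red x v) w = cons_red x (foldr cons_red v w)"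
proof (cases v)
  case Nil
  then show ?thesis by simp
next
  case (Cons y ys)
  have "is_reduced (foldr cons_red ys w)" using assms by (rule foldr_cons_red_reduced)
  from cons_red_cancel [OF this, of "inv_letter x"] Cons show ?thesis by auto
qed

lemma foldr_cons_red_assoc:
  "is_reduced w \<Longrightarrow> foldr cons_red (foldr cons_red u v) w = foldr cons_red u (foldr cons_red v w)"
  by (induction u) (auto simp: foldr_cons_red_cons_red)

lemma foldr_cons_red_reduced_form:
  "is_reduced w \<Longrightarrow> foldr cons_red (reduced_form v) w = foldr cons_red v w"
  by (simp add: reduced_form_def foldr_cons_red_assoc)

lemma reduced_form_append:
  "reduced_form (v @ w) = foldr cons_red v (reduced_form w)"
  by (simp add: reduced_form_def)

lemma cons_red_letters:
  "x \<in> letters r \<Longrightarrow> w \<in> lists (letters r) \<Longrightarrow> cons_red x w \<in> lists (letters r)"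
  by (cases w) auto

lemma reduced_form_letters:
  "w \<in> lists (letters r) \<Longrightarrow> reduced_form w \<in> lists (letters r)"
  unfolding reduced_form_def
  by (induction w) (simp_all add: cons_red_letters del: in_lists_conv_set)

lemma reduced_form_inverse:
  "is_reduced w \<Longrightarrow> foldr cons_red (rev (map inv_letter v)) (foldr cons_red v w) = w"
  by (induction v) (auto simp: cons_red_cancel foldr_cons_red_reduced)

lemma group_free_grp: "group (free_grp r)"
proof (rule groupI)
  fix x y z
  assume "x \<in> carrier (free_grp r)" "y \<in> carrier (free_grp r)" "z \<in> carrier (free_grp r)"
  then show "x \<otimes>\<^bsub>free_grp r\<^esub> y \<otimes>\<^bsub>free_grp r\<^esub> z =
      x \<otimes>\<^bsub>free_grp r\<^esub> (y \<otimes>\<^bsub>free_grp r\<^esub> z)"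
    by (auto simp: free_grp_def reduced_words_def reduced_form_append reduced_form_id
        foldr_cons_red_reduced foldr_cons_red_assoc)
next
  fix x assume x: "x \<in> carrier (free_grp r)"
  let ?y = "reduced_form (rev (map inv_letter x))"
  have "x \<in> lists (letters r)" "is_reduced x" using x by (auto simp: free_grp_def reduced_words_def)
  moreover have "rev (map inv_letter x) \<in> lists (letters r)" using calculation by auto
  ultimately have "?y \<in> carrier (free_grp r)"
    by (simp add: free_grp_def reduced_words_def reduced_form_reduced reduced_form_letters
        del: in_lists_conv_set)
  moreover have "?y \<otimes>\<^bsub>free_grp r\<^esub> x = \<one>\<^bsub>free_grp r\<^esub>"
    using reduced_form_inverse [of "[]" x] \<open>is_reduced x\<close>
    by (simp add: free_grp_def reduced_form_append foldr_cons_red_reduced_form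
        reduced_form_id is_reduced_def flip: reduced_form_def)
  ultimately show "\<exists>y\<in>carrier (free_grp r). y \<otimes>\<^bsub>free_grp r\<^esub> x = \<one>\<^bsub>free_grp r\<^esub>"
    by blast
qed (auto simp: free_grp_def reduced_words_def reduced_form_reduced reduced_form_id
    intro!: reduced_form_letters simp del: in_lists_conv_set)

subsection \<open>The boundary\<close>

text \<open>Sequences are indexed from \<open>0\<close>: \<open>\<xi> i\<close> is the letter usually written \<open>\<xi>\<^bsub>i+1\<^esub>\<close>.\<close>

definition boundary :: "nat \<Rightarrow> (nat \<Rightarrow> letter) set"
  where "boundary r = {\<xi>. \<forall>i. \<xi> i \<in> letters r \<and> \<xi> (Suc i) \<noteq> inv_letter (\<xi> i)}"

definition cylinder :: "nat \<Rightarrow> letter list \<Rightarrow> (nat \<Rightarrow> letter) set"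
  where "cylinder r s = {\<xi> \<in> boundary r. \<forall>i<length s. \<xi> i = s ! i}"

text \<open>The measure \<open>\<nu>\<close>. The cylinders form a countable base of the topology of the boundary, so the
  \<open>\<sigma>\<close>-algebra they generate is the Borel one. The empty word is left out because the formula for
  the measure of a cylinder is only meant for words of positive length; total mass \<open>1\<close> follows by
  adding up the \<open>2r\<close> cylinders of length \<open>1\<close>. For \<open>r \<ge> 2\<close> the prescribed values are consistent
  (each cylinder splits into \<open>2r - 1\<close> cylinders of equal measure), and they determine the measure,
  since two cylinders are nested or disjoint.\<close>

definition boundary_measure :: "nat \<Rightarrow> (nat \<Rightarrow> letter) measure"
  where "boundary_measure r =
    extend_measure (boundary r) (reduced_words r - {[]}) (cylinder r)
      (\<lambda>s. ennreal (inverse (2 * real r) * inverse ((2 * real r - 1) ^ (length s - 1))))"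

text \<open>The number of letters cancelled when \<open>t\<close> is concatenated with \<open>\<xi>\<close>.\<close>

definition cancellation :: "letter list \<Rightarrow> (nat \<Rightarrow> letter) \<Rightarrow> nat"
  where "cancellation t \<xi> =
    Max {k. k \<le> length t \<and> (\<forall>i<k. inv_letter (\<xi> i) = t ! (length t - 1 - i))}"

definition boundary_act :: "letter list \<Rightarrow> (nat \<Rightarrow> letter) \<Rightarrow> (nat \<Rightarrow> letter)"
  where "boundary_act t \<xi> =
    (let k = cancellation t \<xi>; m = length t - k
     in (\<lambda>i. if i < m then t ! i else \<xi> (k + (i - m))))"

text \<open>The explicit version of the derivative of \<open>\<nu> \<circ> t\<close> with respect to \<open>\<nu>\<close>.\<close>

definition boundary_deriv :: "nat \<Rightarrow> letter list \<Rightarrow> (nat \<Rightarrow> letter) \<Rightarrow> real"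
  where "boundary_deriv r t \<xi> =
    (2 * real r - 1) powi (2 * int (cancellation t \<xi>) - int (length t))"

definition horosphere :: "nat \<Rightarrow> (nat \<Rightarrow> letter) \<Rightarrow> letter list set"
  where "horosphere r \<xi> =
    {g \<in> carrier (free_grp r). boundary_deriv r (inv\<^bsub>free_grp r\<^esub> g) \<xi> = 1}"

subsection \<open>Non-singular actions\<close>

text \<open>Borel spaces of Polish topologies; no type-class topology on \<open>'a\<close> is involved.\<close>

definition standard_borel_space :: "'a measure \<Rightarrow> bool"
  where "standard_borel_space M \<longleftrightarrow>
    (\<exists>T. topspace T = space M \<and> completely_metrizable_space T \<and> second_countable T \<and>
         sets M = sigma_sets (space M) {U. openin T U})"

definition nonsingular_action ::
    "('g, 'b) monoid_scheme \<Rightarrow> 'a measure \<Rightarrow> ('g \<Rightarrow> 'a \<Rightarrow> 'a) \<Rightarrow> bool"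
  where "nonsingular_action G M \<phi> \<longleftrightarrow>
    group_action G (space M) \<phi> \<and>
    (\<forall>g\<in>carrier G. \<phi> g \<in> M \<rightarrow>\<^sub>M M \<and>
       (\<forall>A\<in>sets M. emeasure M (\<phi> g -` A \<inter> space M) = 0 \<longleftrightarrow> emeasure M A = 0))"

subsection \<open>The diagonal action on \<open>X \<times> \<partial>F\<close>\<close>

definition prod_measure :: "nat \<Rightarrow> 'a measure \<Rightarrow> ('a \<times> (nat \<Rightarrow> letter)) measure"
  where "prod_measure r M = M \<Otimes>\<^sub>M boundary_measure r"

definition diag_act ::
    "(letter list \<Rightarrow> 'a \<Rightarrow> 'a) \<Rightarrow> letter list \<Rightarrow> 'a \<times> (nat \<Rightarrow> letter) \<Rightarrow> 'a \<times> (nat \<Rightarrow> letter)"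
  where "diag_act \<phi> g p = (\<phi> g (fst p), boundary_act g (snd p))"

definition T_hat ::
    "nat \<Rightarrow> 'a measure \<Rightarrow> (letter list \<Rightarrow> 'a \<Rightarrow> 'a) \<Rightarrow> letter list \<Rightarrow>
      ('a \<times> (nat \<Rightarrow> letter) \<Rightarrow> real) \<Rightarrow> 'a \<times> (nat \<Rightarrow> letter) \<Rightarrow> real"
  where "T_hat r M \<phi> g u p =
    u (diag_act \<phi> (inv\<^bsub>free_grp r\<^esub> g) p) *
    enn2real (RN_deriv (prod_measure r M)
      (distr (prod_measure r M) (prod_measure r M) (diag_act \<phi> g)) p)"

definition ratio ::
    "nat \<Rightarrow> 'a measure \<Rightarrow> (letter list \<Rightarrow> 'a \<Rightarrow> 'a) \<Rightarrow> nat \<Rightarrow>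
      ('a \<times> (nat \<Rightarrow> letter) \<Rightarrow> real) \<Rightarrow> ('a \<times> (nat \<Rightarrow> letter) \<Rightarrow> real) \<Rightarrow>
      'a \<times> (nat \<Rightarrow> letter) \<Rightarrow> real"
  where "ratio r M \<phi> N u v p =
    (\<Sum>g\<in>{g \<in> horosphere r (snd p). length g \<le> N}. T_hat r M \<phi> g u p) /
    (\<Sum>g\<in>{g \<in> horosphere r (snd p). length g \<le> N}. T_hat r M \<phi> g v p)"

subsection \<open>The horospherical relation\<close>

definition R0 ::
    "nat \<Rightarrow> 'a measure \<Rightarrow> (letter list \<Rightarrow> 'a \<Rightarrow> 'a) \<Rightarrow>
      (('a \<times> (nat \<Rightarrow> letter)) \<times> ('a \<times> (nat \<Rightarrow> letter))) set"
  where "R0 r M \<phi> =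
    {(p, q). p \<in> space (prod_measure r M) \<and>
       (\<exists>g\<in>horosphere r (snd p). q = diag_act \<phi> (inv\<^bsub>free_grp r\<^esub> g) p)}"

definition invariant_mod_null :: "'c measure \<Rightarrow> ('c \<times> 'c) set \<Rightarrow> ('c \<Rightarrow> real) \<Rightarrow> bool"
  where "invariant_mod_null P R f \<longleftrightarrow>
    (\<exists>N\<in>null_sets P. \<forall>p\<in>space P - N. \<forall>q\<in>space P - N. (p, q) \<in> R \<longrightarrow> f p = f q)"

definition ergodic_relation :: "'c measure \<Rightarrow> ('c \<times> 'c) set \<Rightarrow> bool"
  where "ergodic_relation P R \<longleftrightarrow>
    (\<forall>A\<in>sets P. invariant_mod_null P R (indicator A) \<longrightarrow>
       A \<in> null_sets P \<or> space P - A \<in> null_sets P)"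

end

theory Submission
  imports Defs
begin

text \<open>Let \<open>S (x, \<xi>) = (\<xi>\<^sub>1\<^sup>-\<^sup>1 x, (\<xi>\<^sub>2, \<xi>\<^sub>3, \<dots>))\<close> on \<open>X \<times> \<partial>F\<close>. The \<open>g\<close> in the horosphere of \<open>\<xi>\<close> with
  \<open>|g| \<le> 2n\<close> are those for which \<open>g\<^sup>-\<^sup>1 \<xi>\<close> arises from \<open>\<xi>\<close> by replacing its first \<open>n\<close> letters, and
  the corresponding points \<open>g\<^sup>-\<^sup>1 (x, \<xi>)\<close> form the fibre of \<open>S\<^sup>n\<close> through \<open>(x, \<xi>)\<close>. The horospherical
  relation is thus the tail relation of \<open>S\<close>, an increasing union of finite relations. With respect to
  the finite measure \<open>v d(\<lambda> \<times> \<nu>)\<close> the ratio of index \<open>2n\<close> is the conditional expectation of \<open>u / v\<close>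
  given the \<open>\<sigma>\<close>-algebra generated by \<open>S\<^sup>n\<close>. These \<open>\<sigma>\<close>-algebras decrease, so the reverse martingale
  theorem gives the limit.\<close>

section \<open>Reverse martingales\<close>

text \<open>The obstacle is that \<open>T_hat\<close> carries one Radon-Nikodym derivative for each
  \<open>g\<close>, fixed only up to null sets, while the ratio sums over a set of \<open>g\<close>
  that varies with the point. The identification with a conditional expectation therefore goes by
  duality. Integrated against a bounded test function, each derivative turns into a change of
  variables, and the transposed operator is an unweighted sum over a fibre of \<open>S^n\<close>,
  hence a function of \<open>S^n (x, \<xi>)\<close> alone. Functions of this kind are what the
  defining property of h = E(u / v) speaks about, so they annihilate u - v h. Consequently the
  weighted sum of u - v h vanishes almost everywhere, and h, being constant on fibres, comes out of
  the sum as the ratio. The measure v d(\<lambda> \<times> \<nu>) is finite even if \<lambda> is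
  infinite, which brings the problem into the range of martingale theory. The constant in the
  ergodic case comes from the fact that a reverse martingale also converges in L^1, so that its
  limit keeps the integral of u / v.\<close>

locale decreasing_filtration = finite_measure M for M :: "'a measure" +
  fixes F :: "nat \<Rightarrow> 'a measure"
  assumes subalg: "subalgebra M (F n)"
    and subalg_Suc: "subalgebra (F n) (F (Suc n))"
begin

lemma subalg_mono: "m \<le> n \<Longrightarrow> subalgebra (F m) (F n)"
proof (induction rule: dec_induct)
  case (step n)
  then show ?case using subalg_Suc[of n] by (auto simp: subalgebra_def)
qed (simp add: subalgebra_def)

sublocale subalg: finite_measure_subalgebra M "F n" for n
  by unfold_locales (rule subalg)

abbreviation E :: "nat \<Rightarrow> ('a \<Rightarrow> real) \<Rightarrow> 'a \<Rightarrow> real"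
  where "E n \<equiv> real_cond_exp M (F n)"

lemma cond_exp_measurable_mono: "m \<le> n \<Longrightarrow> E n f \<in> borel_measurable (F m)"
  using measurable_from_subalg[OF subalg_mono] borel_measurable_cond_exp by blast

section \<open>L^1 bounds and a maximal inequality for conditional expectations\<close>

lemma abs_cond_exp_le:
  assumes [measurable]: "integrable M f"
  shows "AE x in M. \<bar>E n f x\<bar> \<le> E n (\<lambda>x. \<bar>f x\<bar>) x"
proof -
  have "AE x in M. E n f x \<le> E n (\<lambda>x. \<bar>f x\<bar>) x"
    by (rule subalg.real_cond_exp_mono) (use assms in auto)
  moreover have "AE x in M. E n (\<lambda>x. - 1 * f x) x \<le> E n (\<lambda>x. \<bar>f x\<bar>) x"
    by (rule subalg.real_cond_exp_mono) (use assms in auto)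
  moreover have "AE x in M. E n (\<lambda>x. - 1 * f x) x = - 1 * E n f x"
    by (rule subalg.real_cond_exp_cmult) (use assms in auto)
  ultimately show ?thesis by eventually_elim auto
qed

lemma cond_exp_L1_contraction:
  assumes "integrable M f"
  shows "(\<integral>x. \<bar>E n f x\<bar> \<partial>M) \<le> (\<integral>x. \<bar>f x\<bar> \<partial>M)"
proof -
  have "(\<integral>x. \<bar>E n f x\<bar> \<partial>M) \<le> (\<integral>x. E n (\<lambda>x. \<bar>f x\<bar>) x \<partial>M)"
    by (rule integral_mono_AE) (use assms abs_cond_exp_le subalg.real_cond_exp_int(1) in auto)
  also have "\<dots> = (\<integral>x. \<bar>f x\<bar> \<partial>M)"
    by (rule subalg.real_cond_exp_int(2)) (use assms in auto)
  finally show ?thesis .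
qed

text \<open>Decompose the event according to the \<^emph>\<open>last\<close> index at which the level is exceeded: since the
  filtration decreases, that index is the analogue of a stopping time.\<close>

lemma maximal_inequality:
  assumes g: "integrable M g" "AE x in M. 0 \<le> g x"
  shows "c * measure M {x \<in> space M. \<exists>n\<in>{m..N}. c < E n g x} \<le> (\<integral>x. g x \<partial>M)"
proof -
  define D where "D n = {x \<in> space M. c < E n g x \<and> (\<forall>j\<in>{n<..N}. E j g x \<le> c)}" for n
  have spF: "space (F n) = space M" for n using subalg[of n] by (simp add: subalgebra_def)
  \<comment> \<open>Membership in \<open>D n\<close> involves only indices from \<open>n\<close> on,
    and those expectations are \<open>F n\<close>-measurable since the filtration decreases. This is
    what later allows \<open>E n g\<close> to be replaced by \<open>g\<close> under the integral
    over \<open>D n\<close>.\<close>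
  have DF: "D n \<in> sets (F n)" for n
  proof -
    note meas = cond_exp_measurable_mono[of n _ g]
    have "{x \<in> space (F n). c < E n g x \<and> (\<forall>j\<in>{n<..N}. E j g x \<le> c)} \<in> sets (F n)"
    proof (intro sets.sets_Collect_conj sets.sets_Collect_finite_All)
      show "{x \<in> space (F n). E j g x \<le> c} \<in> sets (F n)" if "j \<in> {n<..N}" for j
        using borel_measurable_le[OF meas[of j]] that by simp
    qed (use borel_measurable_less[OF _ meas[of n]] in auto)
    then show ?thesis unfolding D_def spF .
  qed
  then have [measurable]: "D n \<in> sets M" for n using subalg[of n] by (auto simp: subalgebra_def)
  have disj: "disjoint_family_on D {m..N}"
    unfolding disjoint_family_on_def D_def
    by (auto, metis greaterThanAtMost_iff linorder_neqE_nat not_le)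
  have ex: "\<exists>n\<in>{m..N}. x \<in> D n" if "x \<in> space M" "n \<in> {m..N}" "c < E n g x" for x n
  proof -
    let ?P = "\<lambda>n. n \<in> {m..N} \<and> c < E n g x"
    let ?n = "Max {n. ?P n}"
    have fin: "finite {n. ?P n}" by simp
    have "?P ?n" using Max_in[OF fin] that by blast
    moreover have "E j g x \<le> c" if "j \<in> {?n<..N}" for j
    proof (rule ccontr)
      assume "\<not> E j g x \<le> c"
      then have "?P j" using that \<open>?P ?n\<close> by auto
      then have "j \<le> ?n" by (intro Max_ge[OF fin]) simp
      then show False using that by simp
    qed
    ultimately show ?thesis using that(1) by (auto simp: D_def)
  qed
  have un: "{x \<in> space M. \<exists>n\<in>{m..N}. c < E n g x} = (\<Union>n\<in>{m..N}. D n)"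
    using ex by (auto simp: D_def)
  have si: "set_integrable M (D n) g" "set_integrable M (D n) (E n g)" for n
    unfolding set_integrable_def
    by (intro integrable_mult_indicator g subalg.real_cond_exp_int(1); simp)+
  have "c * measure M (\<Union>n\<in>{m..N}. D n) = (\<Sum>n\<in>{m..N}. c * measure M (D n))"
    by (subst finite_measure_finite_Union) (auto simp: sum_distrib_left disj)
  also have "\<dots> \<le> (\<Sum>n\<in>{m..N}. \<integral>x\<in>D n. g x \<partial>M)"
  proof (rule sum_mono)
    fix n
    have "c * measure M (D n) = (\<integral>x\<in>D n. c \<partial>M)"
      by (simp add: set_lebesgue_integral_def)
    also have "\<dots> \<le> (\<integral>x\<in>D n. E n g x \<partial>M)"
      unfolding set_lebesgue_integral_def
    proof (rule integral_mono)
      show "integrable M (\<lambda>x. indicat_real (D n) x *\<^sub>R c)"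
        by (intro integrable_mult_indicator) simp_all
      show "integrable M (\<lambda>x. indicat_real (D n) x *\<^sub>R E n g x)"
        using si(2)[of n] by (simp add: set_integrable_def)
    qed (auto simp: D_def indicator_def)
    also have "\<dots> = (\<integral>x\<in>D n. g x \<partial>M)"
      by (rule subalg.real_cond_exp_intA[symmetric]) (use DF g in auto)
    finally show "c * measure M (D n) \<le> (\<integral>x\<in>D n. g x \<partial>M)" .
  qed
  also have "\<dots> = (\<integral>x\<in>(\<Union>n\<in>{m..N}. D n). g x \<partial>M)"
    by (rule set_integral_finite_Union[symmetric]) (simp_all add: disj si)
  also have "\<dots> \<le> (\<integral>x. g x \<partial>M)"
    unfolding set_lebesgue_integral_def
  proof (rule integral_mono_AE)
    show "integrable M (\<lambda>x. indicat_real (\<Union>n\<in>{m..N}. D n) x *\<^sub>R g x)"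
      by (intro integrable_mult_indicator g) simp
  qed (use g in \<open>auto simp: indicator_def\<close>)
  finally show ?thesis by (simp add: un)
qed

text \<open>In L^2, \<open>E n f\<close> is the orthogonal projection of \<open>E k f\<close> for k
  \<le> n. By Pythagoras the squared distance of the two is the drop \<open>a k - a n\<close> of the
  squared norms. These norms decrease and are nonnegative, hence converge, which gives the Cauchy
  property in L^2 and, the measure being finite, in L^1.\<close>

lemma L1_Cauchy_bounded:
  assumes [measurable]: "f \<in> borel_measurable M" and K: "\<And>x. \<bar>f x\<bar> \<le> K" and "0 < e"
  shows "\<exists>m. \<forall>k\<ge>m. \<forall>n\<ge>k. (\<integral>x. \<bar>E k f x - E n f x\<bar> \<partial>M) \<le> e"
proof -
  have f: "integrable M f" by (rule integrable_const_bound[of _ K]) (use K in auto)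
  have "0 \<le> K" using K[of undefined] by linarith
  have bd: "AE x in M. \<bar>E n f x\<bar> \<le> K" for n
  proof -
    have "AE x in M. - K \<le> E n f x"
      by (rule subalg.real_cond_exp_ge_c) (use f K in \<open>auto simp: abs_le_iff minus_le_iff\<close>)
    moreover have "AE x in M. E n f x \<le> K"
      by (rule subalg.real_cond_exp_le_c) (use f K in \<open>auto simp: abs_le_iff\<close>)
    ultimately show ?thesis by eventually_elim auto
  qed
  have int: "integrable M (\<lambda>x. E k f x * E n f x)" for k n
  proof (rule integrable_const_bound[of _ "K * K"])
    show "AE x in M. norm (E k f x * E n f x) \<le> K * K"
      using bd[of k] bd[of n] by eventually_elim (auto simp: abs_mult intro!: mult_mono \<open>0 \<le> K\<close>)
  qed measurable
  define a where "a n = (\<integral>x. E n f x * E n f x \<partial>M)" for n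
  have ak: "(\<integral>x. E n f x * E k f x \<partial>M) = a n" if "k \<le> n" for k n
  proof -
    have "(\<integral>x. E n f x * E k f x \<partial>M) = (\<integral>x. E n f x * E n (E k f) x \<partial>M)"
      by (rule subalg.real_cond_exp_intg(2)[symmetric]) (use int in auto)
    also have "\<dots> = a n" unfolding a_def
    proof (rule integral_cong_AE)
      have "AE x in M. E n (E k f) x = E n f x"
        by (rule subalg.real_cond_exp_nested_subalg) (use f subalg subalg_mono that in auto)
      then show "AE x in M. E n f x * E n (E k f) x = E n f x * E n f x" by eventually_elim simp
    qed auto
    finally show ?thesis .
  qed
  have sq: "(\<integral>x. (E k f x - E n f x)\<^sup>2 \<partial>M) = a k - a n" if "k \<le> n" for k n
  proof -
    have "(\<integral>x. (E k f x - E n f x)\<^sup>2 \<partial>M) =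
        (\<integral>x. E k f x * E k f x - 2 * (E n f x * E k f x) + E n f x * E n f x \<partial>M)"
      by (intro Bochner_Integration.integral_cong) (auto simp: power2_eq_square algebra_simps)
    also have "\<dots> = a k - 2 * a n + a n"
      using int ak[OF that] by (simp add: a_def)
    finally show ?thesis by simp
  qed
  have "a n \<le> a k" if "k \<le> n" for k n
    using sq[OF that] integral_nonneg_AE[of "\<lambda>x. (E k f x - E n f x)\<^sup>2" M] by simp
  then have "decseq a" by (simp add: decseq_def)
  moreover have "0 \<le> a n" for n by (simp add: a_def)
  ultimately have "Cauchy a" using decseq_convergent[of a 0] by (metis LIMSEQ_imp_Cauchy)
  \<comment> \<open>This is the weight in |d| \<le> (c + d^2 / c) / 2, the bound used to pass from
    L^2 to L^1. After integration the first term is at most \<open>e\<close> by the choice of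
    \<open>c\<close>, and the second is at most \<open>e\<close> once \<open>a k - a n\<close> is
    below \<open>c * e\<close>. The summand 1 keeps the denominator positive for the zero
    measure.\<close>
  define c where "c = e / (measure M (space M) + 1)"
  have c: "0 < c" "c * measure M (space M) \<le> e"
    using \<open>0 < e\<close> measure_nonneg[of M "space M"]
    by (auto simp: c_def divide_simps add_nonneg_pos)
  obtain m where m: "\<And>k n. k \<ge> m \<Longrightarrow> n \<ge> m \<Longrightarrow> \<bar>a k - a n\<bar> < c * e"
    using \<open>Cauchy a\<close> c \<open>0 < e\<close> unfolding Cauchy_def dist_real_def by (metis mult_pos_pos)
  have "(\<integral>x. \<bar>E k f x - E n f x\<bar> \<partial>M) \<le> e" if "k \<ge> m" "n \<ge> k" for k n
  proof -
    let ?d = "\<lambda>x. E k f x - E n f x"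
    have i2: "integrable M (\<lambda>x. (?d x)\<^sup>2)"
      unfolding power2_eq_square using int by (simp add: algebra_simps)
    have i1: "integrable M ?d" using f subalg.real_cond_exp_int(1) by auto
    have "\<bar>d\<bar> \<le> (c + d\<^sup>2 / c) / 2" for d :: real
    proof -
      have "0 \<le> (\<bar>d\<bar> - c)\<^sup>2" by simp
      then have "2 * c * \<bar>d\<bar> \<le> c * c + d\<^sup>2" by (simp add: power2_eq_square algebra_simps)
      then show ?thesis using c by (simp add: field_simps)
    qed
    then have "(\<integral>x. \<bar>?d x\<bar> \<partial>M) \<le> (\<integral>x. (c + (?d x)\<^sup>2 / c) / 2 \<partial>M)"
      by (intro integral_mono) (use i1 i2 in auto)
    also have "\<dots> = (c * measure M (space M) + (a k - a n) / c) / 2"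
      using i2 sq[OF that(2)] by simp
    also have "\<dots> \<le> (e + e) / 2"
    proof -
      have "a k - a n \<le> e * c" using m[of k n] that by (simp add: mult.commute)
      then have "(a k - a n) / c \<le> e" using c by (simp add: pos_divide_le_eq)
      then have "c * measure M (space M) + (a k - a n) / c \<le> e + e" using c(2) by (rule add_mono[rotated])
      then show ?thesis by (rule divide_right_mono) simp
    qed
    finally show ?thesis by simp
  qed
  then show ?thesis by blast
qed

text \<open>Truncation at a level \<open>K\<close> gives a bounded function close to
  \<open>f\<close> in L^1. Conditional expectation contracts L^1, so the truncation error costs
  \<open>e / 3\<close> at each of the two indices, uniformly in them, and the bounded case supplies
  the remaining third.\<close>

lemma L1_Cauchy:
  assumes f: "integrable M f" and "0 < e"
  shows "\<exists>m. \<forall>k\<ge>m. \<forall>n\<ge>k. (\<integral>x. \<bar>E k f x - E n f x\<bar> \<partial>M) \<le> e"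
proof -
  note [measurable] = borel_measurable_integrable[OF f]
  define g where "g K x = max (- real K) (min (real K) (f x))" for K x
  have [measurable]: "g K \<in> borel_measurable M" for K unfolding g_def by measurable
  have gK: "\<bar>g K x\<bar> \<le> real K" for K x by (auto simp: g_def)
  have gi: "integrable M (g K)" for K by (rule integrable_const_bound[of _ K]) (use gK in auto)
  have "(\<lambda>K. \<integral>x. \<bar>f x - g K x\<bar> \<partial>M) \<longlonglongrightarrow> (\<integral>x. 0 \<partial>M)"
  proof (rule integral_dominated_convergence[where w = "\<lambda>x. \<bar>f x\<bar>"])
    show "AE x in M. (\<lambda>K. \<bar>f x - g K x\<bar>) \<longlonglongrightarrow> 0"
    proof (rule AE_I2, rule tendsto_eventually)
      fix x
      obtain K0 :: nat where "\<bar>f x\<bar> \<le> real K0" using real_arch_simple by blast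
      then show "\<forall>\<^sub>F K in sequentially. \<bar>f x - g K x\<bar> = 0"
        unfolding eventually_sequentially by (intro exI[of _ K0]) (auto simp: g_def)
    qed
  qed (use f in \<open>auto simp: g_def\<close>)
  then have "\<forall>\<^sub>F K in sequentially. (\<integral>x. \<bar>f x - g K x\<bar> \<partial>M) < e / 3"
    using order_tendstoD(2)[of _ 0 _ "e / 3"] \<open>0 < e\<close> by simp
  then obtain K where K: "(\<integral>x. \<bar>f x - g K x\<bar> \<partial>M) < e / 3"
    by (auto simp: eventually_sequentially)
  have "\<exists>m. \<forall>k\<ge>m. \<forall>n\<ge>k. (\<integral>x. \<bar>E k (g K) x - E n (g K) x\<bar> \<partial>M) \<le> e / 3"
    by (rule L1_Cauchy_bounded[of _ "real K"]) (use gK \<open>0 < e\<close> in auto)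
  then obtain m where m: "\<And>k n. k \<ge> m \<Longrightarrow> n \<ge> k \<Longrightarrow> (\<integral>x. \<bar>E k (g K) x - E n (g K) x\<bar> \<partial>M) \<le> e / 3"
    by blast
  let ?h = "\<lambda>x. f x - g K x"
  have Eh: "AE x in M. E n ?h x = E n f x - E n (g K) x" for n
    by (rule subalg.real_cond_exp_diff) (use f gi in auto)
  note I = subalg.real_cond_exp_int(1)
  have ih: "integrable M ?h" using f gi by auto
  have "(\<integral>x. \<bar>E k f x - E n f x\<bar> \<partial>M) \<le> e" if "k \<ge> m" "n \<ge> k" for k n
  proof -
    have "(\<integral>x. \<bar>E k f x - E n f x\<bar> \<partial>M) \<le>
        (\<integral>x. \<bar>E k ?h x\<bar> + \<bar>E k (g K) x - E n (g K) x\<bar> + \<bar>E n ?h x\<bar> \<partial>M)"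
    proof (rule integral_mono_AE)
      show "AE x in M. \<bar>E k f x - E n f x\<bar>
          \<le> \<bar>E k ?h x\<bar> + \<bar>E k (g K) x - E n (g K) x\<bar> + \<bar>E n ?h x\<bar>"
        using Eh[of k] Eh[of n] by eventually_elim auto
    qed (use I f gi ih in auto)
    also have "\<dots> = (\<integral>x. \<bar>E k ?h x\<bar> \<partial>M) + (\<integral>x. \<bar>E k (g K) x - E n (g K) x\<bar> \<partial>M)
        + (\<integral>x. \<bar>E n ?h x\<bar> \<partial>M)"
      using I f gi ih by simp
    also have "\<dots> \<le> e / 3 + e / 3 + e / 3"
      using cond_exp_L1_contraction[OF ih, of k] cond_exp_L1_contraction[OF ih, of n] m[OF that] K
      by linarith
    finally show ?thesis by simp
  qed
  then show ?thesis by blast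
qed

text \<open>For m \<le> n \<le> N the tower property makes \<open>E n f - E N f\<close> the
  conditional expectation of \<open>E m f - E N f\<close> given \<open>F n\<close>. The maximal
  inequality applied to the absolute value of the latter therefore controls the whole window by one
  L^1 distance.\<close>

lemma oscillation_inequality:
  assumes f: "integrable M f"
  shows "e * measure M {x \<in> space M. \<exists>n\<in>{m..N}. e < \<bar>E n f x - E N f x\<bar>}
    \<le> (\<integral>x. \<bar>E m f x - E N f x\<bar> \<partial>M)"
proof (cases "e \<ge> 0")
  case True
  let ?h = "\<lambda>x. E m f x - E N f x"
  note I = subalg.real_cond_exp_int(1)
  have ih: "integrable M ?h" using I f by auto
  have "AE x in M. \<bar>E n f x - E N f x\<bar> \<le> E n (\<lambda>x. \<bar>?h x\<bar>) x" if "n \<in> {m..N}" for n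
  proof -
    have "AE x in M. E n (E m f) x = E n f x"
      by (rule subalg.real_cond_exp_nested_subalg) (use f subalg subalg_mono that in auto)
    moreover have "AE x in M. E n (E N f) x = E N f x"
      by (rule subalg.real_cond_exp_F_meas)
        (use f I cond_exp_measurable_mono that in auto)
    moreover have "AE x in M. E n ?h x = E n (E m f) x - E n (E N f) x"
      by (rule subalg.real_cond_exp_diff) (use f I in auto)
    ultimately show ?thesis using abs_cond_exp_le[OF ih, of n] by eventually_elim simp
  qed
  then have "AE x in M. \<forall>n\<in>{m..N}. \<bar>E n f x - E N f x\<bar> \<le> E n (\<lambda>x. \<bar>?h x\<bar>) x"
    by (intro AE_finite_allI) auto
  then have "measure M {x \<in> space M. \<exists>n\<in>{m..N}. e < \<bar>E n f x - E N f x\<bar>}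
      \<le> measure M {x \<in> space M. \<exists>n\<in>{m..N}. e < E n (\<lambda>x. \<bar>?h x\<bar>) x}"
    by (intro finite_measure_mono_AE) (auto elim!: eventually_mono, force)
  then have "e * measure M {x \<in> space M. \<exists>n\<in>{m..N}. e < \<bar>E n f x - E N f x\<bar>}
      \<le> e * measure M {x \<in> space M. \<exists>n\<in>{m..N}. e < E n (\<lambda>x. \<bar>?h x\<bar>) x}"
    using True by (rule mult_left_mono)
  also have "\<dots> \<le> (\<integral>x. \<bar>?h x\<bar> \<partial>M)"
    by (rule maximal_inequality) (use ih in auto)
  finally show ?thesis .
next
  case False
  then have "e * measure M {x \<in> space M. \<exists>n\<in>{m..N}. e < \<bar>E n f x - E N f x\<bar>} \<le> 0"
    by (simp add: mult_nonpos_nonneg)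
  also have "0 \<le> (\<integral>x. \<bar>E m f x - E N f x\<bar> \<partial>M)" by simp
  finally show ?thesis .
qed

text \<open>The bad sets \<open>B m N\<close> increase with \<open>N\<close>, and for a suitable
  \<open>m\<close> their measures have a bound independent of \<open>N\<close>; continuity from
  below passes it to the union, which contains \<open>Z\<close> for every \<open>m\<close>.\<close>

lemma AE_small_oscillation:
  assumes f: "integrable M f" and "0 < e"
  shows "AE x in M. \<exists>m. \<forall>n\<ge>m. \<forall>k\<ge>m. \<bar>E n f x - E k f x\<bar> \<le> e"
proof -
  define B where "B m N = {x \<in> space M. \<exists>n\<in>{m..N}. \<exists>k\<in>{m..N}. e < \<bar>E n f x - E k f x\<bar>}" for m N
  define Z where "Z = {x \<in> space M. \<forall>m. \<exists>N. x \<in> B m N}"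
  have [measurable]: "B m N \<in> sets M" for m N unfolding B_def by measurable
  have [measurable]: "Z \<in> sets M" unfolding Z_def by measurable
  have "measure M Z \<le> d" if "0 < d" for d
  proof -
    \<comment> \<open>Two members of the window more than \<open>e\<close> apart cannot both lie
      within \<open>e / 2\<close> of \<open>E N f\<close>, so the oscillation inequality is used at
      level \<open>e / 2\<close>. Dividing by this level leaves the bound \<open>d\<close> for the
      measure.\<close>
    obtain m where m: "\<And>k n. k \<ge> m \<Longrightarrow> n \<ge> k \<Longrightarrow> (\<integral>x. \<bar>E k f x - E n f x\<bar> \<partial>M) \<le> e / 2 * d"
      using L1_Cauchy[OF f, of "e / 2 * d"] \<open>0 < e\<close> \<open>0 < d\<close> by auto
    have Bd: "measure M (B m N) \<le> d" for N
    proof (cases "m \<le> N")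
      case True
      let ?C = "{x \<in> space M. \<exists>n\<in>{m..N}. e / 2 < \<bar>E n f x - E N f x\<bar>}"
      have "B m N \<subseteq> ?C"
      proof
        fix x assume "x \<in> B m N"
        then obtain n k where nk: "x \<in> space M" "n \<in> {m..N}" "k \<in> {m..N}" "e < \<bar>E n f x - E k f x\<bar>"
          by (auto simp: B_def)
        then have "e / 2 < \<bar>E n f x - E N f x\<bar> \<or> e / 2 < \<bar>E k f x - E N f x\<bar>" by linarith
        then show "x \<in> ?C" using nk by blast
      qed
      then have "measure M (B m N) \<le> measure M ?C" by (intro finite_measure_mono) auto
      then have "e / 2 * measure M (B m N) \<le> e / 2 * measure M ?C"
        using \<open>0 < e\<close> by (intro mult_left_mono) auto
      also have "\<dots> \<le> e / 2 * d"
        using oscillation_inequality[OF f, of "e / 2" m N] m[OF order_refl True] by linarith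
      finally show ?thesis using \<open>0 < e\<close> by simp
    next
      case False
      then have "B m N = {}" by (auto simp: B_def)
      then show ?thesis using \<open>0 < d\<close> by simp
    qed
    have "(\<lambda>N. measure M (B m N)) \<longlonglongrightarrow> measure M (\<Union>N. B m N)"
      by (rule finite_Lim_measure_incseq)
        (force simp: incseq_def B_def intro: order_trans)+
    then have "measure M (\<Union>N. B m N) \<le> d" by (rule LIMSEQ_le_const2) (use Bd in auto)
    moreover have "measure M Z \<le> measure M (\<Union>N. B m N)"
      by (rule finite_measure_mono) (auto simp: Z_def)
    ultimately show ?thesis by simp
  qed
  then have "measure M Z = 0" using field_le_epsilon[of "measure M Z" 0] measure_nonneg[of M Z] by auto
  then have "AE x in M. x \<notin> Z" by (intro AE_not_in null_setsI) (simp_all add: emeasure_eq_measure)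
  then show ?thesis
  proof (rule AE_mp, intro AE_I2 impI)
    fix x assume x: "x \<in> space M" "x \<notin> Z"
    then obtain m where m: "\<And>N. x \<notin> B m N" by (auto simp: Z_def)
    have "\<bar>E n f x - E k f x\<bar> \<le> e" if "n \<ge> m" "k \<ge> m" for n k
      using m[of "max n k"] that x(1) by (auto simp: B_def not_less dest!: bspec[where x = n])
    then show "\<exists>m. \<forall>n\<ge>m. \<forall>k\<ge>m. \<bar>E n f x - E k f x\<bar> \<le> e" by blast
  qed
qed

theorem reverse_martingale_convergence:
  assumes f: "integrable M f"
  shows "AE x in M. (\<lambda>n. E n f x) \<longlonglongrightarrow> lim (\<lambda>n. E n f x)"
proof -
  have "AE x in M. \<forall>j. \<exists>m. \<forall>n\<ge>m. \<forall>k\<ge>m. \<bar>E n f x - E k f x\<bar> \<le> inverse (real (Suc j))"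
    unfolding AE_all_countable by (intro allI AE_small_oscillation f) simp
  then show ?thesis
  proof eventually_elim
    case (elim x)
    have "Cauchy (\<lambda>n. E n f x)"
      unfolding Cauchy_def dist_real_def
    proof (intro allI impI)
      fix e :: real assume "0 < e"
      then obtain j where "inverse (real (Suc j)) < e" using reals_Archimedean by blast
      with elim show "\<exists>m. \<forall>n\<ge>m. \<forall>k\<ge>m. \<bar>E n f x - E k f x\<bar> < e" by (meson order_le_less_trans)
    qed
    then show ?case using Cauchy_convergent convergent_LIMSEQ_iff by blast
  qed
qed

text \<open>Pointwise convergence alone does not preserve integrals. Fatou's lemma in the second
  index turns the L^1 Cauchy estimate into a bound by \<open>e\<close> for the L^1 distance of
  \<open>E m f\<close> and \<open>w\<close>, and every \<open>E m f\<close> has the integral of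
  \<open>f\<close>.\<close>

theorem reverse_martingale_integral:
  assumes f: "integrable M f" and w [measurable]: "w \<in> borel_measurable M"
    and lim: "AE x in M. (\<lambda>n. E n f x) \<longlonglongrightarrow> w x"
  shows "integrable M w" "(\<integral>x. w x \<partial>M) = (\<integral>x. f x \<partial>M)"
proof -
  note I = subalg.real_cond_exp_int
  have approx: "integrable M w \<and> \<bar>(\<integral>x. f x \<partial>M) - (\<integral>x. w x \<partial>M)\<bar> \<le> e" if "0 < e" for e
  proof -
    obtain m where m: "\<And>n. n \<ge> m \<Longrightarrow> (\<integral>x. \<bar>E m f x - E n f x\<bar> \<partial>M) \<le> e"
      using L1_Cauchy[OF f \<open>0 < e\<close>] by blast
    have "(\<integral>\<^sup>+x. ennreal \<bar>E m f x - w x\<bar> \<partial>M)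
        = (\<integral>\<^sup>+x. liminf (\<lambda>n. ennreal \<bar>E m f x - E n f x\<bar>) \<partial>M)"
    proof (rule nn_integral_cong_AE)
      show "AE x in M. ennreal \<bar>E m f x - w x\<bar> = liminf (\<lambda>n. ennreal \<bar>E m f x - E n f x\<bar>)"
        using lim
      proof eventually_elim
        case (elim x)
        then have "(\<lambda>n. ennreal \<bar>E m f x - E n f x\<bar>) \<longlonglongrightarrow> ennreal \<bar>E m f x - w x\<bar>"
          by (intro tendsto_ennrealI tendsto_rabs tendsto_diff tendsto_const)
        then show ?case by (rule lim_imp_Liminf[OF sequentially_bot, symmetric])
      qed
    qed
    also have "\<dots> \<le> liminf (\<lambda>n. \<integral>\<^sup>+x. ennreal \<bar>E m f x - E n f x\<bar> \<partial>M)"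
      by (rule nn_integral_liminf) measurable
    also have "\<dots> \<le> ennreal e"
    proof (rule Liminf_le)
      have "(\<integral>\<^sup>+x. ennreal \<bar>E m f x - E n f x\<bar> \<partial>M) \<le> ennreal e" if "n \<ge> m" for n
        using m[OF that] by (subst nn_integral_eq_integral) (use I(1) f in \<open>auto intro: ennreal_leI\<close>)
      then show "\<forall>\<^sub>F n in sequentially. (\<integral>\<^sup>+x. ennreal \<bar>E m f x - E n f x\<bar> \<partial>M) \<le> ennreal e"
        unfolding eventually_sequentially by blast
    qed simp
    finally have le: "(\<integral>\<^sup>+x. ennreal \<bar>E m f x - w x\<bar> \<partial>M) \<le> ennreal e" .
    have id: "integrable M (\<lambda>x. E m f x - w x)"
      by (rule integrableI_bounded) (use le in \<open>auto intro: le_less_trans\<close>)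
    have iw: "integrable M w"
      using Bochner_Integration.integrable_diff[OF I(1)[OF f, of m] id] by simp
    have "ennreal (\<integral>x. \<bar>E m f x - w x\<bar> \<partial>M) \<le> ennreal e"
      using le id by (subst (asm) nn_integral_eq_integral) auto
    then have "(\<integral>x. \<bar>E m f x - w x\<bar> \<partial>M) \<le> e" using \<open>0 < e\<close> by simp
    moreover have "(\<integral>x. f x \<partial>M) - (\<integral>x. w x \<partial>M) = (\<integral>x. E m f x - w x \<partial>M)"
      using I f iw by simp
    moreover have "\<bar>\<integral>x. E m f x - w x \<partial>M\<bar> \<le> (\<integral>x. \<bar>E m f x - w x\<bar> \<partial>M)"
      by (rule integral_abs_bound)
    ultimately show ?thesis using iw by linarith
  qed
  show "integrable M w" using approx[of 1] by simp
  have "\<bar>(\<integral>x. f x \<partial>M) - (\<integral>x. w x \<partial>M)\<bar> \<le> 0"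
    by (rule field_le_epsilon) (use approx in auto)
  then show "(\<integral>x. w x \<partial>M) = (\<integral>x. f x \<partial>M)" by simp
qed

end

section \<open>Words and boundary sequences\<close>

definition inv_word :: "letter list \<Rightarrow> letter list"
  where "inv_word w = rev (map inv_letter w)"

definition drop_seq :: "nat \<Rightarrow> (nat \<Rightarrow> letter) \<Rightarrow> nat \<Rightarrow> letter"
  where "drop_seq n \<xi> = (\<lambda>i. \<xi> (n + i))"

definition prepend :: "letter list \<Rightarrow> (nat \<Rightarrow> letter) \<Rightarrow> nat \<Rightarrow> letter"
  where "prepend w \<xi> = (\<lambda>i. if i < length w then w ! i else \<xi> (i - length w))"

definition take_seq :: "nat \<Rightarrow> (nat \<Rightarrow> letter) \<Rightarrow> letter list"
  where "take_seq n \<xi> = map \<xi> [0..<n]"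

definition act_letter :: "letter \<Rightarrow> (nat \<Rightarrow> letter) \<Rightarrow> nat \<Rightarrow> letter"
  where "act_letter x \<xi> = (if \<xi> 0 = inv_letter x then drop_seq 1 \<xi> else prepend [x] \<xi>)"

text \<open>Folding single letters makes sense for unreduced words too and is multiplicative under
  concatenation by construction, whereas \<open>boundary_act\<close> searches for a maximal
  cancellation. The two agree on reduced words by \<open>boundary_act_eq_act_word\<close>.\<close>

definition act_word :: "letter list \<Rightarrow> (nat \<Rightarrow> letter) \<Rightarrow> nat \<Rightarrow> letter"
  where "act_word = foldr act_letter"

text \<open>The Busemann cocycle: the exponent \<open>2k - n\<close> of \<open>2r - 1\<close> in the derivative of \<open>\<nu> \<circ> w\<close>.\<close>

fun busemann :: "letter list \<Rightarrow> (nat \<Rightarrow> letter) \<Rightarrow> int"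
  where
    "busemann [] \<xi> = 0"
  | "busemann (x # w) \<xi> = (if act_word w \<xi> 0 = inv_letter x then 1 else - 1) + busemann w \<xi>"

lemma act_word_simps [simp]:
  "act_word [] \<xi> = \<xi>" "act_word (x # w) \<xi> = act_letter x (act_word w \<xi>)"
  by (simp_all add: act_word_def)

lemma act_word_append [simp]: "act_word (v @ w) \<xi> = act_word v (act_word w \<xi>)"
  by (induction v) auto

lemma busemann_append [simp]: "busemann (v @ w) \<xi> = busemann v (act_word w \<xi>) + busemann w \<xi>"
  by (induction v) auto

lemma inv_word_simps [simp]:
  "inv_word [] = []" "inv_word (v @ w) = inv_word w @ inv_word v" "inv_word [x] = [inv_letter x]"
  "inv_word (inv_word w) = w" "length (inv_word w) = length w"
  by (simp_all add: inv_word_def rev_map comp_def)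

lemma inv_word_Cons: "inv_word (x # w) = inv_word w @ [inv_letter x]"
  by (simp add: inv_word_def)

lemma take_seq_simps [simp]:
  "take_seq 0 \<xi> = []" "take_seq (Suc n) \<xi> = take_seq n \<xi> @ [\<xi> n]" "length (take_seq n \<xi>) = n"
  by (simp_all add: take_seq_def)

lemma hd_take_seq: "0 < n \<Longrightarrow> hd (take_seq n \<xi>) = \<xi> 0"
  by (simp add: take_seq_def hd_map)

lemma take_seq_add: "take_seq (m + n) \<xi> = take_seq m \<xi> @ take_seq n (drop_seq m \<xi>)"
  by (induction n) (auto simp: drop_seq_def)

lemma drop_seq_simps [simp]: "drop_seq 0 \<xi> = \<xi>" "drop_seq m (drop_seq n \<xi>) = drop_seq (n + m) \<xi>" "drop_seq n \<xi> i = \<xi> (n + i)"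
  by (simp_all add: drop_seq_def fun_eq_iff add.assoc)

lemma prepend_Nil [simp]: "prepend [] \<xi> = \<xi>"
  by (simp add: prepend_def)

lemma prepend_Cons: "prepend (x # w) \<xi> = prepend [x] (prepend w \<xi>)"
  by (auto simp: prepend_def fun_eq_iff nth_Cons split: nat.splits)

lemma prepend_0: "prepend w \<xi> 0 = (if w = [] then \<xi> 0 else hd w)"
  by (simp add: prepend_def hd_conv_nth)

lemma drop_seq_prepend [simp]: "length w = n \<Longrightarrow> drop_seq n (prepend w \<xi>) = \<xi>"
  by (auto simp: drop_seq_def prepend_def)

lemma take_seq_prepend [simp]: "length w = n \<Longrightarrow> take_seq n (prepend w \<xi>) = w"
  by (auto simp: take_seq_def prepend_def intro: nth_equalityI)

lemma prepend_take_seq_drop_seq [simp]: "prepend (take_seq n \<xi>) (drop_seq n \<xi>) = \<xi>"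
  by (auto simp: prepend_def take_seq_def drop_seq_def)

lemma inv_word_eq_Nil [simp]: "inv_word w = [] \<longleftrightarrow> w = []"
  by (simp add: inv_word_def)

lemma last_inv_word: "w \<noteq> [] \<Longrightarrow> last (inv_word w) = inv_letter (hd w)"
  by (simp add: inv_word_def last_rev hd_map)

lemma is_reduced_singleton [simp]: "is_reduced [x]"
  by (simp add: is_reduced_def)

lemma is_reduced_append:
  "is_reduced (v @ w) \<longleftrightarrow>
    is_reduced v \<and> is_reduced w \<and> (v = [] \<or> w = [] \<or> last v \<noteq> inv_letter (hd w))"
  by (auto simp: is_reduced_def successively_append_iff inv_letter_eq_iff)

lemma is_reduced_Cons: "is_reduced (x # w) \<longleftrightarrow> is_reduced w \<and> (w = [] \<or> x \<noteq> inv_letter (hd w))"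
  using is_reduced_append[of "[x]" w] by (simp add: is_reduced_def)

lemma is_reduced_inv_word [simp]: "is_reduced (inv_word w) \<longleftrightarrow> is_reduced w"
proof -
  have "is_reduced w \<Longrightarrow> is_reduced (inv_word w)" for w
    by (induction w)
      (auto simp: inv_word_Cons is_reduced_append is_reduced_Cons last_inv_word inv_letter_eq_iff)
  from this[of w] this[of "inv_word w"] show ?thesis by auto
qed

lemma inv_word_reduced_words [simp]: "inv_word w \<in> reduced_words r \<longleftrightarrow> w \<in> reduced_words r"
  by (auto simp: reduced_words_def) (auto simp: inv_word_def)

section \<open>Boundary sequences under shifting, prepending and cancellation\<close>

lemma boundary_letter: "\<xi> \<in> boundary r \<Longrightarrow> \<xi> i \<in> letters r"
  and boundary_step: "\<xi> \<in> boundary r \<Longrightarrow> \<xi> (Suc i) \<noteq> inv_letter (\<xi> i)"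
  by (auto simp: boundary_def)

lemma drop_seq_boundary: "\<xi> \<in> boundary r \<Longrightarrow> drop_seq n \<xi> \<in> boundary r"
  by (auto simp: boundary_def)

lemma take_seq_reduced_words: "\<xi> \<in> boundary r \<Longrightarrow> take_seq n \<xi> \<in> reduced_words r"
proof (induction n)
  case (Suc n)
  have "take_seq n \<xi> = [] \<or> last (take_seq n \<xi>) = \<xi> (n - 1) \<and> 0 < n"
    by (cases n) auto
  with Suc boundary_step[of \<xi> r "n - 1"] boundary_letter[of \<xi> r n] show ?case
    by (auto simp: reduced_words_def is_reduced_append inv_letter_eq_iff)
qed (simp add: reduced_words_def)

lemma prepend_letter_boundary:
  assumes "x \<in> letters r" "\<xi> \<in> boundary r" "\<xi> 0 \<noteq> inv_letter x"
  shows "prepend [x] \<xi> \<in> boundary r"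
  unfolding boundary_def
proof (intro CollectI allI)
  show "prepend [x] \<xi> i \<in> letters r \<and> prepend [x] \<xi> (Suc i) \<noteq> inv_letter (prepend [x] \<xi> i)" for i
    using assms boundary_letter[OF assms(2)] boundary_step[OF assms(2)]
    by (cases i) (auto simp: prepend_def)
qed

lemma prepend_boundary:
  assumes "w \<in> reduced_words r" "\<xi> \<in> boundary r" "w = [] \<or> last w \<noteq> inv_letter (\<xi> 0)"
  shows "prepend w \<xi> \<in> boundary r"
  using assms
proof (induction w)
  case (Cons x w)
  have w: "w \<in> reduced_words r" "x \<in> letters r" "w = [] \<or> x \<noteq> inv_letter (hd w)"
    using Cons.prems(1) by (auto simp: reduced_words_def is_reduced_Cons)
  with Cons have \<eta>: "prepend w \<xi> \<in> boundary r" by (auto split: if_splits)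
  moreover have "prepend w \<xi> 0 \<noteq> inv_letter x"
    using w Cons.prems(3) by (auto simp: prepend_0 inv_letter_eq_iff)
  ultimately show ?case using w(2)
    by (subst prepend_Cons) (rule prepend_letter_boundary)
qed simp

lemma act_letter_boundary:
  "\<xi> \<in> boundary r \<Longrightarrow> x \<in> letters r \<Longrightarrow> act_letter x \<xi> \<in> boundary r"
  unfolding act_letter_def
  by (auto intro!: drop_seq_boundary prepend_boundary
      simp: reduced_words_def is_reduced_def inv_letter_eq_iff)

lemma act_word_boundary:
  "\<xi> \<in> boundary r \<Longrightarrow> w \<in> lists (letters r) \<Longrightarrow> act_word w \<xi> \<in> boundary r"
  by (induction w) (auto intro: act_letter_boundary)

text \<open>If \<open>x\<close> deletes \<open>\<xi> 0\<close>, the letter exposed is not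
  \<open>x\<close>, because neighbours in \<xi> never cancel; so the inverse letter is prepended
  again and restores \<xi>. The second claim says that the Busemann steps of \<open>x\<close> and of
  its inverse have opposite signs.\<close>

lemma act_letter_cancel:
  assumes "\<xi> \<in> boundary r"
  shows "act_letter (inv_letter x) (act_letter x \<xi>) = \<xi>"
    and "(act_letter x \<xi> 0 = x) \<longleftrightarrow> \<xi> 0 \<noteq> inv_letter x"
proof -
  have "\<xi> 1 \<noteq> inv_letter (\<xi> 0)" using boundary_step[OF assms, of 0] by simp
  moreover have "prepend [\<xi> 0] (drop_seq 1 \<xi>) = \<xi>" using prepend_take_seq_drop_seq[of 1 \<xi>] by simp
  ultimately show "act_letter (inv_letter x) (act_letter x \<xi>) = \<xi>"
    "(act_letter x \<xi> 0 = x) \<longleftrightarrow> \<xi> 0 \<noteq> inv_letter x"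
    by (auto simp: act_letter_def prepend_0)
qed

text \<open>A reduction removes a letter next to its inverse; their actions undo each other and
  their Busemann steps add up to 0. Hence the letterwise action and cocycle descend to the free
  group.\<close>

lemma act_word_cons_red:
  assumes "\<xi> \<in> boundary r" "w \<in> lists (letters r)"
  shows "act_word (cons_red x w) \<xi> = act_word (x # w) \<xi>"
    and "busemann (cons_red x w) \<xi> = busemann (x # w) \<xi>"
proof -
  have *: "act_word (cons_red x w) \<xi> = act_word (x # w) \<xi> \<and>
      busemann (cons_red x w) \<xi> = busemann (x # w) \<xi>"
  proof (cases w)
    case (Cons y ys)
    then have \<eta>: "act_word ys \<xi> \<in> boundary r" using assms by (intro act_word_boundary) auto
    show ?thesis
      using act_letter_cancel[OF \<eta>, of "inv_letter x"] by (auto simp: Cons)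
  qed simp
  from * show "act_word (cons_red x w) \<xi> = act_word (x # w) \<xi>"
    "busemann (cons_red x w) \<xi> = busemann (x # w) \<xi>" by blast+
qed

lemma reduced_form_action:
  assumes "\<xi> \<in> boundary r" "w \<in> lists (letters r)"
  shows "act_word (reduced_form w) \<xi> = act_word w \<xi>"
    and "busemann (reduced_form w) \<xi> = busemann w \<xi>"
proof -
  have "act_word (reduced_form w) \<xi> = act_word w \<xi> \<and> busemann (reduced_form w) \<xi> = busemann w \<xi>"
    using assms(2)
  proof (induction w)
    case (Cons x w)
    have red: "reduced_form (x # w) = cons_red x (reduced_form w)" by (simp add: reduced_form_def)
    have "reduced_form w \<in> lists (letters r)" by (intro reduced_form_letters) (rule Cons.hyps)
    then show ?case using Cons act_word_cons_red[OF assms(1)] by (simp add: red)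
  qed (simp add: reduced_form_def)
  then show "act_word (reduced_form w) \<xi> = act_word w \<xi>"
    "busemann (reduced_form w) \<xi> = busemann w \<xi>" by blast+
qed

lemma act_word_inv_take_seq:
  "act_word (inv_word (take_seq n \<xi>)) \<xi> = drop_seq n \<xi>" "busemann (inv_word (take_seq n \<xi>)) \<xi> = int n"
proof -
  have "act_word (inv_word (take_seq n \<xi>)) \<xi> = drop_seq n \<xi> \<and> busemann (inv_word (take_seq n \<xi>)) \<xi> = int n"
    by (induction n) (auto simp: act_letter_def)
  then show "act_word (inv_word (take_seq n \<xi>)) \<xi> = drop_seq n \<xi>"
    "busemann (inv_word (take_seq n \<xi>)) \<xi> = int n" by auto
qed

lemma act_word_prepend:
  assumes "is_reduced w" "w = [] \<or> last w \<noteq> inv_letter (\<xi> 0)"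
  shows "act_word w \<xi> = prepend w \<xi>" "busemann w \<xi> = - int (length w)"
proof -
  have "act_word w \<xi> = prepend w \<xi> \<and> busemann w \<xi> = - int (length w)"
    using assms
  proof (induction w)
    case (Cons x w)
    have "prepend w \<xi> 0 \<noteq> inv_letter x"
      using Cons.prems by (auto simp: is_reduced_Cons prepend_0 inv_letter_eq_iff split: if_splits)
    then show ?case using Cons
      by (auto simp: is_reduced_Cons act_letter_def prepend_Cons[of x w] split: if_splits)
  qed simp
  then show "act_word w \<xi> = prepend w \<xi>" "busemann w \<xi> = - int (length w)" by auto
qed

text \<open>This splits the action of \<open>w\<close> into deleting \<open>k\<close> letters and
  then prepending \<open>t\<close> without any cancellation. The condition on the last letter of
  \<open>t\<close> is the maximality of \<open>k\<close>: otherwise one more letter would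
  cancel.\<close>

lemma cancellation_decomposition:
  obtains k t where "w = t @ inv_word (take_seq k \<xi>)" "t = [] \<or> last t \<noteq> inv_letter (\<xi> k)"
    "cancellation w \<xi> = k" "boundary_act w \<xi> = prepend t (drop_seq k \<xi>)"
proof -
  let ?P = "\<lambda>k. k \<le> length w \<and> (\<forall>i<k. inv_letter (\<xi> i) = w ! (length w - 1 - i))"
  define k where "k = cancellation w \<xi>"
  define t where "t = take (length w - k) w"
  have fin: "finite {k. ?P k}" by (rule finite_subset[of _ "{..length w}"]) auto
  have k: "k = Max {k. ?P k}" by (simp add: k_def cancellation_def)
  have Pk: "?P k" using Max_in[OF fin] unfolding k by blast
  have len: "length t = length w - k" by (simp add: t_def)
  have "drop (length w - k) w = inv_word (take_seq k \<xi>)"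
  proof (rule nth_equalityI)
    fix i assume "i < length (drop (length w - k) w)"
    then have i: "i < k" using Pk by simp
    then have "inv_letter (\<xi> (k - 1 - i)) = w ! (length w - 1 - (k - 1 - i))" using Pk by simp
    moreover have "length w - 1 - (k - 1 - i) = length w - k + i" using i Pk by simp
    ultimately show "drop (length w - k) w ! i = inv_word (take_seq k \<xi>) ! i"
      using i Pk by (simp add: inv_word_def take_seq_def rev_nth)
  qed (use Pk in simp)
  then have w: "w = t @ inv_word (take_seq k \<xi>)" unfolding t_def by (metis append_take_drop_id)
  moreover have "t = [] \<or> last t \<noteq> inv_letter (\<xi> k)"
  proof (rule ccontr)
    assume *: "\<not> ?thesis"
    then have lt: "k < length w" using len by (cases t) auto
    have last: "last t = w ! (length w - 1 - k)"
    proof -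
      have "last t = t ! (length t - 1)" using * by (intro last_conv_nth) blast
      also have "\<dots> = w ! (length w - 1 - k)" using lt len by (simp add: t_def)
      finally show ?thesis .
    qed
    then have "?P (Suc k)" using * Pk lt last by (auto simp: less_Suc_eq)
    then have "Suc k \<le> k" unfolding k by (intro Max_ge[OF fin]) simp
    then show False by simp
  qed
  moreover have "boundary_act w \<xi> = prepend t (drop_seq k \<xi>)"
    unfolding boundary_act_def Let_def prepend_def drop_seq_def k_def[symmetric] len
    by (auto simp: t_def)
  ultimately show thesis using that k_def by metis
qed

lemma boundary_act_eq_act_word:
  assumes "is_reduced w"
  shows "boundary_act w \<xi> = act_word w \<xi>"
    and "2 * int (cancellation w \<xi>) - int (length w) = busemann w \<xi>"
proof -
  obtain k t where *: "w = t @ inv_word (take_seq k \<xi>)" "t = [] \<or> last t \<noteq> inv_letter (\<xi> k)"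
    "cancellation w \<xi> = k" "boundary_act w \<xi> = prepend t (drop_seq k \<xi>)"
    by (rule cancellation_decomposition)
  have t: "is_reduced t" using assms *(1) by (simp add: is_reduced_append)
  note a = act_word_prepend[OF t, of "drop_seq k \<xi>"] act_word_inv_take_seq[of k \<xi>]
  have "act_word w \<xi> = prepend t (drop_seq k \<xi>)" using a *(2) by (simp add: *(1))
  then show "boundary_act w \<xi> = act_word w \<xi>" by (simp add: *(4))
  have "busemann w \<xi> = - int (length t) + int k" using a *(2) by (simp add: *(1))
  then show "2 * int (cancellation w \<xi>) - int (length w) = busemann w \<xi>"
    by (simp add: *(3)) (simp add: *(1))
qed

text \<open>These are the admissible replacements for the first \<open>n\<close> letters of a
  sequence \<xi> with \<open>\<xi> n = y\<close>: the condition on the last letter keeps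
  \<open>prepend s (drop_seq n \<xi>)\<close> in the boundary.\<close>

definition extensions :: "nat \<Rightarrow> nat \<Rightarrow> letter \<Rightarrow> letter list set"
  where "extensions r n y =
    {s \<in> reduced_words r. length s = n \<and> (s = [] \<or> last s \<noteq> inv_letter y)}"

lemma length_reduced_form: "length (reduced_form w) \<le> length w"
proof (induction w)
  case (Cons x w)
  have "length (cons_red x v) \<le> Suc (length v)" for v by (cases v) auto
  with Cons show ?case by (force simp: reduced_form_def intro: order_trans)
qed (simp add: reduced_form_def)

lemma reduced_form_cancel: "reduced_form (u @ v @ inv_word v @ w) = reduced_form (u @ w)"
proof -
  have "reduced_form (v @ inv_word v @ w) = reduced_form w"
    using reduced_form_inverse[of "reduced_form w" "inv_word v"]
    by (simp add: reduced_form_append reduced_form_reduced flip: inv_word_def)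
  then show ?thesis using reduced_form_append by metis
qed

text \<open>An element with vanishing cocycle deletes as many letters as it inserts, so it is
  \<open>t\<close> times the inverse of the first \<open>k\<close> letters, with \<open>t\<close> of
  length k \<le> n. Padding both factors with the letters of \<xi> at positions \<open>k\<close> to
  \<open>n - 1\<close> leaves the group element unchanged and brings the number of deletions to
  exactly \<open>n\<close>. Injectivity holds because \<open>s\<close> can be read off the image
  sequence. The elements described are the inverses of those in the horosphere.\<close>

lemma horospherical_elements:
  assumes \<xi>: "\<xi> \<in> boundary r"
  shows "bij_betw (\<lambda>s. reduced_form (s @ inv_word (take_seq n \<xi>))) (extensions r n (\<xi> n))
      {g \<in> reduced_words r. length g \<le> 2 * n \<and> busemann g \<xi> = 0}"
    and "s \<in> extensions r n (\<xi> n) \<Longrightarrow>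
      act_word (reduced_form (s @ inv_word (take_seq n \<xi>))) \<xi> = prepend s (drop_seq n \<xi>)"
proof -
  let ?g = "\<lambda>s. reduced_form (s @ inv_word (take_seq n \<xi>))"
  have pre: "inv_word (take_seq n \<xi>) \<in> reduced_words r" by (simp add: take_seq_reduced_words \<xi>)
  have g: "act_word (?g s) \<xi> = prepend s (drop_seq n \<xi>) \<and> ?g s \<in> reduced_words r \<and>
      length (?g s) \<le> 2 * n \<and> busemann (?g s) \<xi> = 0" if "s \<in> extensions r n (\<xi> n)" for s
  proof -
    have s: "s \<in> reduced_words r" "length s = n" "s = [] \<or> last s \<noteq> inv_letter (\<xi> n)"
      using that by (auto simp: extensions_def)
    have w: "s @ inv_word (take_seq n \<xi>) \<in> lists (letters r)"
      using s pre by (auto simp: reduced_words_def)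
    have "is_reduced s" using s by (simp add: reduced_words_def)
    note a = act_word_prepend[OF this, of "drop_seq n \<xi>"] act_word_inv_take_seq[of n \<xi>]
    show ?thesis
      using a s length_reduced_form[of "s @ inv_word (take_seq n \<xi>)"] w
      by (auto simp: reduced_form_action[OF \<xi>] reduced_words_def reduced_form_reduced
          simp del: in_lists_conv_set intro!: reduced_form_letters)
  qed
  then show "s \<in> extensions r n (\<xi> n) \<Longrightarrow> act_word (?g s) \<xi> = prepend s (drop_seq n \<xi>)" by blast
  have "inj_on ?g (extensions r n (\<xi> n))"
  proof (rule inj_onI)
    fix s s' assume "s \<in> extensions r n (\<xi> n)" "s' \<in> extensions r n (\<xi> n)" "?g s = ?g s'"
    then have "prepend s (drop_seq n \<xi>) = prepend s' (drop_seq n \<xi>)" "length s = n" "length s' = n"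
      using g by (metis, auto simp: extensions_def)
    then show "s = s'" by (metis take_seq_prepend)
  qed
  moreover have "w \<in> ?g ` extensions r n (\<xi> n)"
    if w: "w \<in> reduced_words r" "length w \<le> 2 * n" "busemann w \<xi> = 0" for w
  proof -
    obtain k t where *: "w = t @ inv_word (take_seq k \<xi>)" "t = [] \<or> last t \<noteq> inv_letter (\<xi> k)"
      "cancellation w \<xi> = k" by (rule cancellation_decomposition)
    have "is_reduced w" using w(1) by (simp add: reduced_words_def)
    then have "2 * int k - int (length w) = 0"
      using boundary_act_eq_act_word(2) w(3) *(3) by metis
    then have len: "length t = k" "k \<le> n" using *(1) w(2) by auto
    let ?s = "t @ take_seq (n - k) (drop_seq k \<xi>)"
    have pk: "take_seq (n - k) (drop_seq k \<xi>) \<in> reduced_words r"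
      by (intro take_seq_reduced_words drop_seq_boundary \<xi>)
    have t: "t \<in> reduced_words r" using w(1) *(1) by (auto simp: reduced_words_def is_reduced_append)
    have last: "last (take_seq m \<eta>) = \<eta> (m - 1)" if "0 < m" for m \<eta>
      using that by (cases m) auto
    have "?s \<in> extensions r n (\<xi> n)"
    proof (cases "k = n")
      case True
      then show ?thesis using t len *(2) by (auto simp: extensions_def)
    next
      case False
      then have "0 < n - k" using len by simp
      moreover have "\<xi> (n - 1) \<noteq> inv_letter (\<xi> n)"
        using boundary_step[OF \<xi>, of "n - 1"] False len by (auto simp: inv_letter_eq_iff)
      moreover have "take_seq (n - k) (drop_seq k \<xi>) \<noteq> []" using \<open>0 < n - k\<close> by (metis length_greater_0_conv take_seq_simps(3))
      ultimately show ?thesis using pk t len *(2) hd_take_seq last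
        by (auto simp: extensions_def reduced_words_def is_reduced_append)
    qed
    moreover have "?g ?s = w"
    proof -
      have "take_seq n \<xi> = take_seq k \<xi> @ take_seq (n - k) (drop_seq k \<xi>)"
        using take_seq_add[of k "n - k" \<xi>] len by simp
      then have "?g ?s = reduced_form w"
        using reduced_form_cancel[of t "take_seq (n - k) (drop_seq k \<xi>)"] by (simp add: *(1))
      then show ?thesis using \<open>is_reduced w\<close> by (simp add: reduced_form_id)
    qed
    ultimately show ?thesis by blast
  qed
  ultimately show "bij_betw ?g (extensions r n (\<xi> n))
      {g \<in> reduced_words r. length g \<le> 2 * n \<and> busemann g \<xi> = 0}"
    unfolding bij_betw_def using g by (auto 0 3)
qed

section \<open>Group operations, and the horosphere as a zero set of the Busemann cocycle\<close>

lemma carrier_free_grp [simp]: "carrier (free_grp r) = reduced_words r"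
  by (simp add: free_grp_def)

lemma mult_free_grp [simp]: "v \<otimes>\<^bsub>free_grp r\<^esub> w = reduced_form (v @ w)"
  by (simp add: free_grp_def)

lemma one_free_grp [simp]: "\<one>\<^bsub>free_grp r\<^esub> = []"
  by (simp add: free_grp_def)

lemma inv_free_grp:
  assumes "g \<in> reduced_words r"
  shows "inv\<^bsub>free_grp r\<^esub> g = inv_word g"
proof (rule group.inv_equality[OF group_free_grp])
  show "inv_word g \<otimes>\<^bsub>free_grp r\<^esub> g = \<one>\<^bsub>free_grp r\<^esub>"
    using reduced_form_cancel[of "[]" "inv_word g" "[]"] by (simp add: reduced_form_def)
qed (use assms in auto)

text \<open>For r \<ge> 2 the base 2r - 1 exceeds 1, so the derivative equals 1 only if its exponent
  is 0.\<close>

lemma horosphere_eq: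
  assumes "r \<ge> 2"
  shows "horosphere r \<xi> = {g \<in> reduced_words r. busemann (inv_word g) \<xi> = 0}"
proof -
  have powi: "a powi m = 1 \<longleftrightarrow> m = 0" if "1 < a" for a :: real and m
    using that one_less_power_int[of a m] one_less_power_int[of a "- m"]
    by (cases m "0 :: int" rule: linorder_cases) (auto simp: power_int_minus)
  have "boundary_deriv r (inv_word g) \<xi> = 1 \<longleftrightarrow> busemann (inv_word g) \<xi> = 0"
    if "g \<in> reduced_words r" for g
  proof -
    have red: "is_reduced (inv_word g)" using that by (simp add: reduced_words_def)
    show ?thesis
      using assms powi unfolding boundary_deriv_def boundary_act_eq_act_word(2)[OF red] by simp
  qed
  then show ?thesis by (auto simp: horosphere_def inv_free_grp)
qed

section \<open>The boundary measure\<close>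

abbreviation cylinder_mass :: "nat \<Rightarrow> letter list \<Rightarrow> real"
  where "cylinder_mass r s \<equiv> inverse (2 * real r) * inverse ((2 * real r - 1) ^ (length s - 1))"

lemma space_boundary_measure [simp]: "space (boundary_measure r) = boundary r"
  unfolding boundary_measure_def by (rule space_extend_measure) (auto simp: cylinder_def)

lemma sets_boundary_measure:
  "sets (boundary_measure r) = sigma_sets (boundary r) (cylinder r ` (reduced_words r - {[]}))"
  unfolding boundary_measure_def by (rule sets_extend_measure) (auto simp: cylinder_def)

text \<open>The existence of \<open>\<nu>\<close> need not be established: \<^const>\<open>extend_measure\<close> falls back to the zero
  measure, for which statements about almost all points are trivial.\<close>

lemma boundary_measure_cases:
  "(\<forall>s\<in>reduced_words r - {[]}.
      emeasure (boundary_measure r) (cylinder r s) = ennreal (cylinder_mass r s)) \<or>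
   emeasure (boundary_measure r) = (\<lambda>_. 0)"
proof -
  let ?\<Omega> = "boundary r" and ?I = "reduced_words r - {[]}" and ?G = "cylinder r"
  let ?\<mu> = "\<lambda>s. ennreal (cylinder_mass r s)"
  show ?thesis
  \<comment> \<open>The case distinction is the condition under which \<open>extend_measure\<close>
    uses an extension; its second conjunct excludes prescribed values that all vanish.\<close>
  proof (cases "(\<exists>\<mu>'. (\<forall>i\<in>?I. \<mu>' (?G i) = ?\<mu> i) \<and> measure_space ?\<Omega> (sigma_sets ?\<Omega> (?G ` ?I)) \<mu>') \<and>
      \<not> (\<forall>i\<in>?I. ?\<mu> i = 0)")
    case True
    then obtain \<mu>' where \<mu>': "\<forall>i\<in>?I. \<mu>' (?G i) = ?\<mu> i"
      "measure_space ?\<Omega> (sigma_sets ?\<Omega> (?G ` ?I)) \<mu>'" by blast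
    have "emeasure (boundary_measure r) (?G i) = ?\<mu> i" if "i \<in> ?I" for i
    proof (rule emeasure_extend_measure[OF boundary_measure_def, where \<mu>' = \<mu>'])
      show "positive (sets (boundary_measure r)) \<mu>'" "countably_additive (sets (boundary_measure r)) \<mu>'"
        using \<mu>'(2) by (auto simp: measure_space_def sets_boundary_measure)
    qed (use \<mu>'(1) that in \<open>auto simp: cylinder_def\<close>)
    then show ?thesis by blast
  next
    case False
    then have "boundary_measure r = sigma ?\<Omega> (?G ` ?I)"
      unfolding boundary_measure_def extend_measure_def by (simp only: if_False)
    then show ?thesis by (simp add: emeasure_sigma)
  qed
qed

section \<open>Cylinders and measurability on the boundary\<close>

lemma finite_letters [simp]: "finite (letters r)"
  by (simp add: letters_def)

lemma card_letters: "card (letters r) = 2 * r"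
  by (simp add: letters_def card_cartesian_product)

lemma finite_words: "finite {w \<in> reduced_words r. length w \<le> n}"
  by (rule finite_subset[OF _ finite_lists_length_le[OF finite_letters, of r n]])
    (auto simp: reduced_words_def)

lemma finite_words_eq: "finite {w \<in> reduced_words r. length w = n}"
  by (rule finite_subset[OF _ finite_words[of r n]]) auto

lemma mem_cylinder_iff: "\<xi> \<in> cylinder r s \<longleftrightarrow> \<xi> \<in> boundary r \<and> take_seq (length s) \<xi> = s"
  by (auto simp: cylinder_def take_seq_def list_eq_iff_nth_eq[of "map \<xi> [0..<length s]" s])

lemma mem_cylinder_Cons_iff:
  "\<xi> \<in> cylinder r (x # s) \<longleftrightarrow> \<xi> \<in> boundary r \<and> \<xi> 0 = x \<and> take_seq (length s) (drop_seq 1 \<xi>) = s"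
  using take_seq_add[of 1 "length s" \<xi>] by (auto simp: mem_cylinder_iff)

lemma cylinder_sets [measurable]: "s \<in> reduced_words r \<Longrightarrow> cylinder r s \<in> sets (boundary_measure r)"
proof (cases "s = []")
  case True
  then have "cylinder r s = space (boundary_measure r)" by (auto simp: cylinder_def)
  then show ?thesis by (metis sets.top)
qed (auto simp: sets_boundary_measure)

lemma measurable_take_seq_words:
  "take_seq n \<in> boundary_measure r \<rightarrow>\<^sub>M count_space (reduced_words r)"
proof -
  have "take_seq n -` {s} \<inter> boundary r = (if length s = n then cylinder r s else {})"
    if "s \<in> reduced_words r" for s
    by (auto simp: mem_cylinder_iff take_seq_reduced_words)
  then show ?thesis
    by (subst measurable_count_space_eq2_countable)
      (auto intro: cylinder_sets take_seq_reduced_words)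
qed

lemma measurable_take_seq [measurable]:
  "take_seq n \<in> boundary_measure r \<rightarrow>\<^sub>M count_space UNIV"
  by (rule measurable_compose[OF measurable_take_seq_words]) simp

lemma measurable_coordinate [measurable]:
  "(\<lambda>\<xi>. \<xi> i) \<in> boundary_measure r \<rightarrow>\<^sub>M count_space UNIV"
proof -
  have "(\<lambda>\<xi>. last (take_seq (Suc i) \<xi>)) \<in> boundary_measure r \<rightarrow>\<^sub>M count_space UNIV"
    by measurable
  then show ?thesis by simp
qed

lemma measurable_boundaryI:
  assumes "f \<in> space N \<rightarrow> boundary r"
    and [measurable]: "\<And>i. (\<lambda>x. f x i) \<in> N \<rightarrow>\<^sub>M count_space UNIV"
  shows "f \<in> N \<rightarrow>\<^sub>M boundary_measure r"
proof (rule measurable_sigma_sets[OF sets_boundary_measure _ assms(1)])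
  fix A assume "A \<in> cylinder r ` (reduced_words r - {[]})"
  then obtain s where A: "A = cylinder r s" by blast
  have "f -` A \<inter> space N = {x \<in> space N. \<forall>i<length s. f x i = s ! i}"
    using assms(1) by (auto simp: A cylinder_def)
  also have "\<dots> \<in> sets N" by measurable
  finally show "f -` A \<inter> space N \<in> sets N" .
qed (auto simp: cylinder_def)

lemma AE_distr_absolutely_continuous:
  assumes T [measurable]: "T \<in> M \<rightarrow>\<^sub>M N" and ac: "absolutely_continuous N (distr M N T)"
    and Q: "AE x in N. Q x"
  shows "AE x in M. Q (T x)"
proof -
  obtain A where A: "A \<in> null_sets N" "{x \<in> space N. \<not> Q x} \<subseteq> A"
    using Q by (auto simp: eventually_ae_filter)
  then have "A \<in> null_sets (distr M N T)" using ac by (auto simp: absolutely_continuous_def)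
  then have "T -` A \<inter> space M \<in> null_sets M" by (simp add: null_sets_distr_iff)
  then show ?thesis
    by (rule AE_I') (use A(2) measurable_space[OF T] in auto)
qed

lemma measurable_act_letter [measurable]:
  assumes "x \<in> letters r"
  shows "act_letter x \<in> boundary_measure r \<rightarrow>\<^sub>M boundary_measure r"
proof (rule measurable_boundaryI)
  show "act_letter x \<in> space (boundary_measure r) \<rightarrow> boundary r"
    using assms by (auto intro: act_letter_boundary)
  fix i
  show "(\<lambda>\<xi>. act_letter x \<xi> i) \<in> boundary_measure r \<rightarrow>\<^sub>M count_space UNIV"
    by (cases i) (auto simp: act_letter_def prepend_def if_distribR cong: if_cong)
qed

lemma measurable_act_word [measurable]:
  "w \<in> lists (letters r) \<Longrightarrow> act_word w \<in> boundary_measure r \<rightarrow>\<^sub>M boundary_measure r"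
proof (induction w)
  case (Cons x w)
  have "act_word (x # w) = act_letter x \<circ> act_word w" by auto
  with Cons show ?case by (auto intro!: measurable_comp measurable_act_letter)
next
  case Nil
  have "act_word [] = (\<lambda>\<xi>. \<xi>)" by auto
  then show ?case by simp
qed

lemma measurable_busemann [measurable]:
  "w \<in> lists (letters r) \<Longrightarrow> busemann w \<in> boundary_measure r \<rightarrow>\<^sub>M count_space UNIV"
proof (induction w)
  case (Cons x w)
  have [measurable]: "act_word w \<in> boundary_measure r \<rightarrow>\<^sub>M boundary_measure r"
    "busemann w \<in> boundary_measure r \<rightarrow>\<^sub>M count_space UNIV"
    using Cons by auto
  have [measurable]: "(\<lambda>\<xi>. act_word w \<xi> 0) \<in> boundary_measure r \<rightarrow>\<^sub>M count_space UNIV"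
    using measurable_compose[OF \<open>act_word w \<in> _\<close> measurable_coordinate] .
  show ?case unfolding busemann.simps by measurable
next
  case Nil
  have "busemann [] = (\<lambda>_. 0)" by auto
  then show ?case by simp
qed

text \<open>The nondegenerate alternative of \<open>boundary_measure_cases\<close>; the zero measure
  is dealt with in the final proof.\<close>

locale boundary_space =
  fixes r :: nat
  assumes r: "2 \<le> r"
    and emeasure_cylinder: "\<And>s. s \<in> reduced_words r \<Longrightarrow> s \<noteq> [] \<Longrightarrow>
      emeasure (boundary_measure r) (cylinder r s) = ennreal (cylinder_mass r s)"
begin

abbreviation "\<nu> \<equiv> boundary_measure r"

lemma emeasure_boundary: "emeasure \<nu> (boundary r) = 1"
proof -
  have w: "[x] \<in> reduced_words r" if "x \<in> letters r" for x
    using that by (simp add: reduced_words_def)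
  have "boundary r = (\<Union>x\<in>letters r. cylinder r [x])"
    by (auto simp: cylinder_def boundary_letter)
  also have "emeasure \<nu> \<dots> = (\<Sum>x\<in>letters r. emeasure \<nu> (cylinder r [x]))"
    by (rule sum_emeasure[symmetric])
      (auto simp: disjoint_family_on_def mem_cylinder_Cons_iff intro: cylinder_sets w)
  also have "\<dots> = (\<Sum>x\<in>letters r. ennreal (inverse (2 * real r)))"
    by (intro sum.cong) (auto simp: emeasure_cylinder w)
  also have "\<dots> = ennreal (2 * real r * inverse (2 * real r))"
    by (subst sum_ennreal) (simp_all add: card_letters)
  finally show ?thesis using r by simp
qed

sublocale prob_space \<nu>
  by (rule prob_spaceI) (simp add: emeasure_boundary)

text \<open>It suffices to compare the measures on the cylinder of a word \<open>s\<close>. If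
  \<open>s\<close> does not begin with \<open>x\<close>, the preimage is the cylinder of x^{-1} s,
  one letter longer, which divides the mass by 2r - 1. If s = x t with \<open>t\<close> nonempty, it
  is the cylinder of \<open>t\<close>, one letter shorter, which multiplies the mass by 2r - 1. If s
  = x, it is the complement of the cylinder of x^{-1}, of mass 1 - 1/(2r) = (2r - 1)/(2r), so the
  same factor results.\<close>

lemma distr_act_letter:
  assumes x: "x \<in> letters r"
  shows "distr \<nu> \<nu> (act_letter x) =
    density \<nu> (\<lambda>\<xi>. ennreal (if \<xi> 0 = x then 2 * real r - 1 else inverse (2 * real r - 1)))"
    (is "?L = ?R")
proof -
  let ?d = "\<lambda>\<xi>. ennreal (if \<xi> 0 = x then 2 * real r - 1 else inverse (2 * real r - 1))"
  \<comment> \<open>Cylinders are nested or disjoint, so adding the empty set makes the family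
    stable under intersection.\<close>
  let ?E = "insert {} (cylinder r ` (reduced_words r - {[]}))"
  have w1: "[y] \<in> reduced_words r" if "y \<in> letters r" for y
    using that by (simp add: reduced_words_def)
  have d[measurable]: "?d \<in> borel_measurable \<nu>" by measurable
  have cyl: "emeasure ?L (cylinder r s) = emeasure ?R (cylinder r s)"
    if s: "s \<in> reduced_words r" "s \<noteq> []" for s
  proof -
    let ?c = "if hd s = x then 2 * real r - 1 else inverse (2 * real r - 1)"
    note [measurable] = cylinder_sets[OF s(1)]
    have "emeasure ?R (cylinder r s) = (\<integral>\<^sup>+\<xi>. ?d \<xi> * indicator (cylinder r s) \<xi> \<partial>\<nu>)"
      by (rule emeasure_density) measurable
    also have "\<dots> = (\<integral>\<^sup>+\<xi>. ennreal ?c * indicator (cylinder r s) \<xi> \<partial>\<nu>)"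
      using s(2) by (intro nn_integral_cong) (auto simp: cylinder_def hd_conv_nth indicator_def)
    also have "\<dots> = ennreal ?c * ennreal (cylinder_mass r s)"
      using emeasure_cylinder[OF s] by (simp add: nn_integral_cmult_indicator)
    also have "\<dots> = ennreal (?c * cylinder_mass r s)"
      using r by (intro ennreal_mult[symmetric]) auto
    finally have R: "emeasure ?R (cylinder r s) = ennreal (?c * cylinder_mass r s)" .
    have L: "emeasure ?L (cylinder r s) = emeasure \<nu> (act_letter x -` cylinder r s \<inter> boundary r)"
      using measurable_act_letter[OF x] by (simp add: emeasure_distr)
    obtain y t where yt: "s = y # t" using s(2) by (cases s) auto
    then have t: "t \<in> reduced_words r" "y \<in> letters r" "t = [] \<or> y \<noteq> inv_letter (hd t)"
      using s(1) by (auto simp: reduced_words_def is_reduced_Cons)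
    have mem: "act_letter x \<xi> \<in> cylinder r s \<longleftrightarrow>
        (if \<xi> 0 = inv_letter x then take_seq (length s) (drop_seq 1 \<xi>) = s
         else y = x \<and> take_seq (length t) \<xi> = t)" if "\<xi> \<in> boundary r" for \<xi>
    proof -
      have "take_seq (length s) (prepend [x] \<xi>) = x # take_seq (length t) \<xi>"
        using take_seq_add[of 1 "length t" "prepend [x] \<xi>"] by (simp add: yt prepend_0)
      then show ?thesis
        using act_letter_boundary[OF that x] by (auto simp: mem_cylinder_iff act_letter_def yt)
    qed
    show ?thesis
    proof (cases "y = x")
      case False
      have "inv_letter x # s \<in> reduced_words r"
        using s(1) x False by (auto simp: reduced_words_def is_reduced_Cons yt inv_letter_eq_iff)
      moreover have "act_letter x -` cylinder r s \<inter> boundary r = cylinder r (inv_letter x # s)"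
        using mem False by (auto simp: mem_cylinder_Cons_iff split: if_splits)
      ultimately show ?thesis
        using False unfolding L R by (simp add: emeasure_cylinder yt mult_ac)
    next
      case True
      have ne: "take_seq (length s) (drop_seq 1 \<xi>) \<noteq> s" if "\<xi> \<in> boundary r" "\<xi> 0 = inv_letter x" for \<xi>
      proof
        assume "take_seq (length s) (drop_seq 1 \<xi>) = s"
        then have "\<xi> 1 = x" using take_seq_add[of 1 "length t" "drop_seq 1 \<xi>"] by (simp add: yt True)
        then show False using boundary_step[OF that(1), of 0] that(2) by simp
      qed
      show ?thesis
      proof (cases "t = []")
        case True': True
        have "act_letter x -` cylinder r s \<inter> boundary r = space \<nu> - cylinder r [inv_letter x]"
          using mem ne True True' by (auto simp: mem_cylinder_iff)
        then have "emeasure ?L (cylinder r s) = emeasure \<nu> (space \<nu> - cylinder r [inv_letter x])"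
          by (simp add: L)
        also have "\<dots> = ennreal (1 - inverse (2 * real r))"
          using x by (subst emeasure_compl)
            (simp_all add: emeasure_cylinder emeasure_boundary w1 ennreal_minus flip: ennreal_1)
        also have "1 - inverse (2 * real r) = ?c * cylinder_mass r s"
          using r True True' by (simp add: yt field_simps)
        finally show ?thesis by (simp add: R)
      next
        case False
        have "act_letter x -` cylinder r s \<inter> boundary r = cylinder r t"
        proof -
          have "\<xi> 0 \<noteq> inv_letter x" if "take_seq (length t) \<xi> = t" for \<xi>
          proof -
            have "hd t = \<xi> 0" using that False hd_take_seq[of "length t" \<xi>] by simp
            then show ?thesis using t(3) False True by (auto simp: inv_letter_eq_iff)
          qed
          then show ?thesis using mem ne True by (auto simp: mem_cylinder_iff split: if_splits)
        qed
        then show ?thesis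
          using r False True t(1) unfolding L R by (cases t) (simp_all add: emeasure_cylinder yt)
      qed
    qed
  qed
  show ?thesis
  proof (rule measure_eqI_generator_eq_countable[where E = ?E and \<Omega> = "boundary r"
        and A = "cylinder r ` (\<lambda>y. [y]) ` letters r"])
    show "Int_stable ?E"
    proof (rule Int_stableI)
      fix A B assume AB: "A \<in> ?E" "B \<in> ?E"
      have *: "cylinder r s \<inter> cylinder r t \<in> ?E"
        if st: "s \<in> reduced_words r - {[]}" "t \<in> reduced_words r - {[]}" "length s \<le> length t" for s t
      proof (cases "take (length s) t = s")
        case True
        then have "cylinder r s \<inter> cylinder r t = cylinder r t"
          using st(3) by (auto simp: cylinder_def) (metis nth_take)
        then show ?thesis using st by blast
      next
        case False
        have "cylinder r s \<inter> cylinder r t = {}"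
        proof (rule ccontr)
          assume "\<not> ?thesis"
          then obtain \<xi> where "take_seq (length s) \<xi> = s" "take_seq (length t) \<xi> = t"
            by (auto simp: mem_cylinder_iff)
          then have "t = s @ take_seq (length t - length s) (drop_seq (length s) \<xi>)"
            using take_seq_add[of "length s" "length t - length s" \<xi>] st(3) by simp
          then show False using False by (metis append_eq_conv_conj)
        qed
        then show ?thesis by blast
      qed
      show "A \<inter> B \<in> ?E"
      proof (cases "A = {} \<or> B = {}")
        case False
        then obtain s t where st: "s \<in> reduced_words r - {[]}" "t \<in> reduced_words r - {[]}"
          "A = cylinder r s" "B = cylinder r t" using AB by blast
        then show ?thesis
          using *[of s t] *[of t s] by (cases "length s \<le> length t") (auto simp: Int_commute)
      qed auto
    qed
    have "sigma_sets (boundary r) ?E = sets \<nu>"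
      unfolding sets_boundary_measure by (rule sigma_sets_eqI) (auto intro: sigma_sets.Empty)
    then show "sets ?L = sigma_sets (boundary r) ?E" "sets ?R = sigma_sets (boundary r) ?E"
      by simp_all
    show "\<Union> (cylinder r ` (\<lambda>y. [y]) ` letters r) = boundary r"
      by (auto simp: mem_cylinder_iff boundary_letter)
    show "emeasure ?L a \<noteq> \<infinity>" if "a \<in> cylinder r ` (\<lambda>y. [y]) ` letters r" for a
      using that w1 by (auto simp: emeasure_distr measurable_act_letter[OF x] cylinder_sets)
    show "emeasure ?L X = emeasure ?R X" if XE: "X \<in> ?E" for X
    proof (cases "X = {}")
      case False
      then obtain s where "s \<in> reduced_words r" "s \<noteq> []" "X = cylinder r s" using XE by blast
      then show ?thesis using cyl by metis
    qed simp
  qed (auto simp: mem_cylinder_iff w1)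
qed


lemma absolutely_continuous_act_letter:
  "x \<in> letters r \<Longrightarrow> absolutely_continuous \<nu> (distr \<nu> \<nu> (act_letter x))"
  by (subst distr_act_letter) (auto intro!: absolutely_continuousI_density)

lemma AE_act_word:
  assumes "w \<in> lists (letters r)" "AE \<xi> in \<nu>. Q \<xi>"
  shows "AE \<xi> in \<nu>. Q (act_word w \<xi>)"
  using assms(1)
proof (induction w rule: rev_induct)
  case (snoc x w)
  then show ?case
    using AE_distr_absolutely_continuous[of "act_letter x" \<nu> \<nu> "\<lambda>\<xi>. Q (act_word w \<xi>)"]
      measurable_act_letter[of x r] absolutely_continuous_act_letter[of x] by simp
qed (simp add: assms(2))

end

section \<open>The diagonal action\<close>

text \<open>The level set of \<open>h\<close> through \<open>x\<close> is a preimage under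
  \<open>f\<close>, so it contains every point of the fibre of \<open>f\<close> through
  \<open>x\<close>.\<close>

lemma vimage_algebra_measurable_eq:
  fixes h :: "'a \<Rightarrow> real"
  assumes "h \<in> borel_measurable (vimage_algebra X f N)" "f \<in> X \<rightarrow> space N"
    and "x \<in> X" "y \<in> X" "f x = f y"
  shows "h x = h y"
proof -
  have "h -` {h x} \<inter> X \<in> sets (vimage_algebra X f N)"
    using measurable_sets[OF assms(1), of "{h x}"] by simp
  then obtain A where A: "h -` {h x} \<inter> X = f -` A \<inter> X"
    unfolding sets_vimage_algebra2[OF assms(2)] by blast
  have "x \<in> h -` {h x} \<inter> X" using assms(3) by simp
  then have "y \<in> h -` {h x} \<inter> X" unfolding A using assms(4,5) by simp
  then show ?thesis by simp
qed

locale horospherical_action = boundary_space r for r :: nat +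
  fixes M :: "'a measure" and \<phi> :: "letter list \<Rightarrow> 'a \<Rightarrow> 'a"
  assumes sigma_finite: "sigma_finite_measure M"
    and nonsingular: "nonsingular_action (free_grp r) M \<phi>"
begin

sublocale M: sigma_finite_measure M by (rule sigma_finite)

sublocale pair: pair_sigma_finite M \<nu> ..

abbreviation "P \<equiv> prod_measure r M"
abbreviation "act \<equiv> diag_act \<phi>"

text \<open>The map \<open>S\<^sup>n\<close>: the acting word is \<open>(\<xi>\<^sub>1 \<cdots> \<xi>\<^sub>n)\<^sup>-\<^sup>1\<close>.\<close>

definition proj :: "nat \<Rightarrow> 'a \<times> (nat \<Rightarrow> letter) \<Rightarrow> 'a \<times> (nat \<Rightarrow> letter)"
  where "proj n p = act (inv_word (take_seq n (snd p))) p"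

sublocale P: sigma_finite_measure P
  unfolding prod_measure_def by (rule pair.sigma_finite_measure_axioms)

lemma space_P: "space P = space M \<times> boundary r"
  by (simp add: prod_measure_def space_pair_measure)

lemma mem_space_P: "p \<in> space P \<longleftrightarrow> fst p \<in> space M \<and> snd p \<in> boundary r"
  by (cases p) (simp add: space_P)

lemma measurable_snd_P: "snd \<in> P \<rightarrow>\<^sub>M \<nu>"
  unfolding prod_measure_def by measurable

lemma phi:
  shows phi_space: "g \<in> reduced_words r \<Longrightarrow> x \<in> space M \<Longrightarrow> \<phi> g x \<in> space M"
    and phi_mult: "u \<in> reduced_words r \<Longrightarrow> w \<in> reduced_words r \<Longrightarrow> x \<in> space M \<Longrightarrow>
      \<phi> (reduced_form (u @ w)) x = \<phi> u (\<phi> w x)"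
    and phi_Nil: "x \<in> space M \<Longrightarrow> \<phi> [] x = x"
    and phi_measurable: "g \<in> reduced_words r \<Longrightarrow> \<phi> g \<in> M \<rightarrow>\<^sub>M M"
    and phi_absolutely_continuous:
      "g \<in> reduced_words r \<Longrightarrow> absolutely_continuous M (distr M M (\<phi> g))"
proof -
  interpret group_action "free_grp r" "space M" \<phi>
    using nonsingular by (simp add: nonsingular_action_def)
  show "g \<in> reduced_words r \<Longrightarrow> x \<in> space M \<Longrightarrow> \<phi> g x \<in> space M"
    using element_image by simp
  show "u \<in> reduced_words r \<Longrightarrow> w \<in> reduced_words r \<Longrightarrow> x \<in> space M \<Longrightarrow>
      \<phi> (reduced_form (u @ w)) x = \<phi> u (\<phi> w x)"
    using composition_rule[of x u w] by simp
  show "x \<in> space M \<Longrightarrow> \<phi> [] x = x"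
    using fun_cong[OF id_eq_one, of x] by simp
  show meas: "g \<in> reduced_words r \<Longrightarrow> \<phi> g \<in> M \<rightarrow>\<^sub>M M" for g
    using nonsingular by (simp add: nonsingular_action_def)
  show "g \<in> reduced_words r \<Longrightarrow> absolutely_continuous M (distr M M (\<phi> g))"
    using nonsingular meas[of g]
    by (auto simp: absolutely_continuous_def nonsingular_action_def null_sets_def emeasure_distr)
qed

lemma snd_act:
  "g \<in> reduced_words r \<Longrightarrow> snd (act g p) = act_word g (snd p)"
  by (simp add: diag_act_def boundary_act_eq_act_word reduced_words_def)

lemma fst_act: "fst (act g p) = \<phi> g (fst p)"
  by (simp add: diag_act_def)

lemma reduced_form_words:
  "u \<in> reduced_words r \<Longrightarrow> w \<in> reduced_words r \<Longrightarrow> reduced_form (u @ w) \<in> reduced_words r"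
  using reduced_form_letters[of "u @ w" r] by (auto simp: reduced_words_def reduced_form_reduced)

lemma act_space: "g \<in> reduced_words r \<Longrightarrow> p \<in> space P \<Longrightarrow> act g p \<in> space P"
  by (auto simp: mem_space_P snd_act fst_act phi_space reduced_words_def intro!: act_word_boundary)

lemma act_mult:
  assumes "u \<in> reduced_words r" "w \<in> reduced_words r" "p \<in> space P"
  shows "act (reduced_form (u @ w)) p = act u (act w p)"
proof (rule prod_eqI)
  show "fst (act (reduced_form (u @ w)) p) = fst (act u (act w p))"
    using assms by (simp add: fst_act phi_mult mem_space_P)
  have "u @ w \<in> lists (letters r)" using assms by (auto simp: reduced_words_def)
  from reduced_form_action(1)[OF _ this, of "snd p"]
  show "snd (act (reduced_form (u @ w)) p) = snd (act u (act w p))"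
    using assms by (simp add: snd_act reduced_form_words mem_space_P)
qed

lemma Nil_words [simp]: "[] \<in> reduced_words r"
  by (simp add: reduced_words_def)

lemma act_Nil: "p \<in> space P \<Longrightarrow> act [] p = p"
  by (rule prod_eqI) (simp_all add: fst_act snd_act phi_Nil mem_space_P)

lemma act_inv_word:
  assumes "g \<in> reduced_words r" "p \<in> space P"
  shows "act (inv_word g) (act g p) = p" "act g (act (inv_word g) p) = p"
proof -
  have "act (inv_word g) (act g p) = p" if "g \<in> reduced_words r" for g
    using act_mult[of "inv_word g" g p] reduced_form_cancel[of "[]" "inv_word g" "[]"] that assms(2)
    by (simp add: act_Nil reduced_form_def)
  from this[of g] this[of "inv_word g"] assms
  show "act (inv_word g) (act g p) = p" "act g (act (inv_word g) p) = p" by simp_all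
qed

lemma busemann_inv_word:
  assumes "g \<in> reduced_words r" "\<xi> \<in> boundary r"
  shows "busemann (inv_word g) (act_word g \<xi>) = - busemann g \<xi>"
proof -
  have "inv_word g @ g \<in> lists (letters r)"
    using assms(1) inv_word_reduced_words[of g r] by (auto simp: reduced_words_def)
  then have "busemann (inv_word g @ g) \<xi> = busemann (reduced_form (inv_word g @ g)) \<xi>"
    by (rule reduced_form_action(2)[OF assms(2), symmetric])
  also have "reduced_form (inv_word g @ g) = []"
    using reduced_form_cancel[of "[]" "inv_word g" "[]"] by (simp add: reduced_form_def)
  finally show ?thesis by simp
qed

section \<open>Measurability and non-singularity of the diagonal action and of its shift\<close>

lemma measurable_act [measurable]:
  assumes g: "g \<in> reduced_words r"
  shows "act g \<in> P \<rightarrow>\<^sub>M P"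
proof -
  have [measurable]: "act_word g \<in> \<nu> \<rightarrow>\<^sub>M \<nu>" "\<phi> g \<in> M \<rightarrow>\<^sub>M M"
    using g by (auto simp: reduced_words_def phi_measurable intro!: measurable_act_word)
  have "(\<lambda>p. (\<phi> g (fst p), act_word g (snd p))) \<in> P \<rightarrow>\<^sub>M P"
    unfolding prod_measure_def by measurable
  moreover have "act g = (\<lambda>p. (\<phi> g (fst p), act_word g (snd p)))"
    using fst_act snd_act[OF g] by (auto simp: fun_eq_iff prod_eq_iff)
  ultimately show ?thesis by simp
qed

lemma absolutely_continuous_act:
  assumes g: "g \<in> reduced_words r"
  shows "absolutely_continuous P (distr P P (act g))"
  unfolding absolutely_continuous_def
proof
  note [measurable] = measurable_act[OF g]
  fix N assume N: "N \<in> null_sets P"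
  then have [measurable]: "N \<in> sets P" by auto
  from N have "AE p in M \<Otimes>\<^sub>M \<nu>. p \<notin> N" using AE_not_in by (simp add: prod_measure_def)
  then have "AE x in M. AE \<xi> in \<nu>. (x, \<xi>) \<notin> N" by (rule pair.AE_pair)
  then have "AE x in M. AE \<xi> in \<nu>. (\<phi> g x, \<xi>) \<notin> N"
    using AE_distr_absolutely_continuous[OF phi_measurable phi_absolutely_continuous] g by blast
  then have "AE x in M. AE \<xi> in \<nu>. act g (x, \<xi>) \<notin> N"
  proof eventually_elim
    case (elim x)
    then show ?case
      using AE_act_word[of g, OF _ elim] g
      by (simp add: diag_act_def boundary_act_eq_act_word reduced_words_def)
  qed
  moreover have "{p \<in> space P. act g p \<notin> N} \<in> sets P" by measurable
  ultimately have "AE p in P. act g p \<notin> N"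
    unfolding prod_measure_def by (intro pair.AE_pair_measure)
  then have "act g -` N \<inter> space P \<in> null_sets P"
    by (subst (asm) AE_iff_null) (auto simp: Collect_conj_eq vimage_def Int_commute)
  then show "N \<in> null_sets (distr P P (act g))"
    by (simp add: null_sets_distr_iff)
qed

text \<open>The Radon-Nikodym rules for \<open>RN\<close> ask for this. The image of a
  \<sigma>-finite measure can fail to be \<sigma>-finite, but here a further push by the inverse of
  \<open>g\<close> returns \<open>P\<close>, and a measure with a \<sigma>-finite image is itself
  \<sigma>-finite.\<close>

lemma sigma_finite_distr_act:
  assumes g: "g \<in> reduced_words r"
  shows "sigma_finite_measure (distr P P (act g))"
proof (rule sigma_finite_measure_distr)
  let ?N = "distr (distr P P (act g)) P (act (inv_word g))"
  have "?N = distr P P (act (inv_word g) \<circ> act g)"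
    using g by (intro distr_distr) simp_all
  also have "\<dots> = distr P P (\<lambda>p. p)"
    using g by (intro distr_cong) (simp_all add: act_inv_word)
  finally show "sigma_finite_measure ?N" by (simp add: distr_id P.sigma_finite_measure_axioms)
  show "act (inv_word g) \<in> distr P P (act g) \<rightarrow>\<^sub>M P"
    using measurable_act[of "inv_word g"] g by simp
qed

text \<open>The acting word varies with the point but takes only countably many values, each on a
  measurable set.\<close>

lemma measurable_proj [measurable]: "proj n \<in> P \<rightarrow>\<^sub>M P"
  unfolding proj_def[abs_def]
proof (rule measurable_compose_countable'[where f = "\<lambda>w. act (inv_word w)" and I = "reduced_words r"])
  show "(\<lambda>p. take_seq n (snd p)) \<in> P \<rightarrow>\<^sub>M count_space (reduced_words r)"
    by (rule measurable_compose[OF measurable_snd_P measurable_take_seq_words])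
  show "countable (reduced_words r)" by simp
qed simp

lemma proj_space: "p \<in> space P \<Longrightarrow> proj n p \<in> space P"
  using measurable_space[OF measurable_proj] .

lemma inv_take_seq_words: "p \<in> space P \<Longrightarrow> inv_word (take_seq n (snd p)) \<in> reduced_words r"
  by (simp add: take_seq_reduced_words mem_space_P)

lemma snd_proj: "p \<in> space P \<Longrightarrow> snd (proj n p) = drop_seq n (snd p)"
  unfolding proj_def using snd_act[OF inv_take_seq_words] act_word_inv_take_seq(1) by simp

text \<open>This semigroup law makes the fibre algebras decrease. The inverse of the first
  \<open>n + 1\<close> letters is reduced as it stands, and its leading letter is the inverse of the
  first boundary letter of \<open>proj n p\<close>.\<close>

lemma proj_Suc:
  assumes p: "p \<in> space P"
  shows "proj (Suc n) p = proj 1 (proj n p)"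
proof -
  let ?\<xi> = "snd p"
  have w: "[inv_letter (?\<xi> n)] \<in> reduced_words r"
    using p by (simp add: reduced_words_def mem_space_P boundary_letter)
  have "inv_word (take_seq (Suc n) ?\<xi>) \<in> reduced_words r" by (rule inv_take_seq_words[OF p])
  then have "is_reduced ([inv_letter (?\<xi> n)] @ inv_word (take_seq n ?\<xi>))"
    by (simp add: reduced_words_def)
  then have "proj (Suc n) p = act (reduced_form ([inv_letter (?\<xi> n)] @ inv_word (take_seq n ?\<xi>))) p"
    unfolding proj_def by (simp add: reduced_form_id)
  also have "\<dots> = act [inv_letter (?\<xi> n)] (proj n p)"
    unfolding proj_def by (rule act_mult[OF w inv_take_seq_words[OF p] p])
  also have "\<dots> = proj 1 (proj n p)"
    unfolding proj_def[of 1] by (simp add: snd_proj[OF p])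
  finally show ?thesis .
qed

text \<open>The first \<open>n\<close> letters of the image sequence are exactly \<open>s\<close>,
  so \<open>proj n\<close> applies the inverse of \<open>s\<close> to
  \<open>act s (proj n p)\<close>.\<close>

lemma act_horospherical:
  assumes p: "p \<in> space P" and s: "s \<in> extensions r n (snd p n)"
  defines "g \<equiv> reduced_form (s @ inv_word (take_seq n (snd p)))"
  shows "act g p = act s (proj n p)" "proj n (act g p) = proj n p"
proof -
  have s': "s \<in> reduced_words r" "length s = n" using s by (auto simp: extensions_def)
  show eq: "act g p = act s (proj n p)"
    unfolding g_def proj_def by (rule act_mult[OF s'(1) inv_take_seq_words[OF p] p])
  have g: "g \<in> reduced_words r"
    unfolding g_def by (rule reduced_form_words[OF s'(1) inv_take_seq_words[OF p]])
  have "snd (act g p) = prepend s (drop_seq n (snd p))"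
    unfolding snd_act[OF g] unfolding g_def
    by (rule horospherical_elements(2)) (use p s in \<open>auto simp: mem_space_P\<close>)
  then have "proj n (act g p) = act (inv_word s) (act g p)"
    by (simp add: proj_def s'(2))
  then show "proj n (act g p) = proj n p"
    by (simp add: eq act_inv_word s'(1) proj_space p)
qed

lemma proj_act:
  assumes p: "p \<in> space P" and g: "g \<in> reduced_words r" "length g \<le> 2 * n" "busemann g (snd p) = 0"
  shows "proj n (act g p) = proj n p"
proof -
  have "g \<in> (\<lambda>s. reduced_form (s @ inv_word (take_seq n (snd p)))) ` extensions r n (snd p n)"
    using bij_betw_imp_surj_on[OF horospherical_elements(1)[of "snd p" r n]] g p
    by (simp add: mem_space_P)
  then show ?thesis using act_horospherical(2)[OF p] by blast
qed

text \<open>The right side depends on \<open>p\<close> only through \<open>proj n p\<close>, and its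
  index set is fixed; this gives measurability of class sums with respect to the fibre
  algebra.\<close>

lemma sum_horospherical:
  assumes p: "p \<in> space P"
  shows "(\<Sum>g | g \<in> reduced_words r \<and> length g \<le> 2 * n \<and> busemann g (snd p) = 0. f (act g p)) =
    (\<Sum>s | s \<in> reduced_words r \<and> length s = n.
      if s = [] \<or> last s \<noteq> inv_letter (snd (proj n p) 0) then f (act s (proj n p)) else (0::real))"
proof -
  have "(\<Sum>g | g \<in> reduced_words r \<and> length g \<le> 2 * n \<and> busemann g (snd p) = 0. f (act g p)) =
      (\<Sum>s\<in>extensions r n (snd p n). f (act (reduced_form (s @ inv_word (take_seq n (snd p)))) p))"
    by (rule sum.reindex_bij_betw[OF horospherical_elements(1), symmetric])
      (use p in \<open>simp add: mem_space_P\<close>)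
  also have "\<dots> = (\<Sum>s\<in>extensions r n (snd p n). f (act s (proj n p)))"
    by (intro sum.cong refl) (simp add: act_horospherical(1)[OF p])
  also have "\<dots> = (\<Sum>s | s \<in> reduced_words r \<and> length s = n.
      if s = [] \<or> last s \<noteq> inv_letter (snd (proj n p) 0) then f (act s (proj n p)) else 0)"
    by (intro sum.mono_neutral_cong_left finite_words_eq)
      (auto simp: extensions_def snd_proj[OF p])
  finally show ?thesis .
qed

subsection \<open>Ratios as conditional expectations\<close>

definition fibre_algebra :: "nat \<Rightarrow> ('a \<times> (nat \<Rightarrow> letter)) measure"
  where "fibre_algebra n = vimage_algebra (space P) (proj n) P"

lemma proj_Pi: "proj n \<in> space P \<rightarrow> space P"
  by (simp add: proj_space)

lemma space_fibre_algebra [simp]: "space (fibre_algebra n) = space P"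
  by (simp add: fibre_algebra_def)

lemma sets_fibre_algebra:
  "sets (fibre_algebra n) = {proj n -` A \<inter> space P | A. A \<in> sets P}"
  unfolding fibre_algebra_def by (rule sets_vimage_algebra2[OF proj_Pi])

lemma subalgebra_fibre_algebra: "subalgebra P (fibre_algebra n)"
  unfolding subalgebra_def sets_fibre_algebra
  using measurable_sets[OF measurable_proj[of n]] by auto

lemma subalgebra_fibre_algebra_Suc: "subalgebra (fibre_algebra n) (fibre_algebra (Suc n))"
proof -
  have "proj (Suc n) -` B \<inter> space P \<in> sets (fibre_algebra n)" if "B \<in> sets P" for B
  proof -
    have "proj (Suc n) -` B \<inter> space P = proj n -` (proj 1 -` B \<inter> space P) \<inter> space P"
      using proj_space proj_Suc by auto
    moreover have "proj 1 -` B \<inter> space P \<in> sets P"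
      by (rule measurable_sets[OF measurable_proj that])
    ultimately show ?thesis unfolding sets_fibre_algebra by blast
  qed
  then show ?thesis
    unfolding subalgebra_def sets_fibre_algebra[of "Suc n"] by auto
qed

lemma fibre_algebra_measurable_eq:
  fixes h :: "'a \<times> (nat \<Rightarrow> letter) \<Rightarrow> real"
  assumes "h \<in> borel_measurable (fibre_algebra n)" "p \<in> space P" "q \<in> space P" "proj n p = proj n q"
  shows "h p = h q"
  using assms(1) unfolding fibre_algebra_def
  by (rule vimage_algebra_measurable_eq[OF _ proj_Pi assms(2-4)])

section \<open>Horospherical sums and their transposes\<close>

definition word_ball :: "nat \<Rightarrow> letter list set"
  where "word_ball n = {g \<in> reduced_words r. length g \<le> 2 * n}"

lemma finite_word_ball [simp]: "finite (word_ball n)"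
  unfolding word_ball_def by (rule finite_words)

lemma word_ball_words: "g \<in> word_ball n \<Longrightarrow> g \<in> reduced_words r" "g \<in> word_ball n \<Longrightarrow> inv_word g \<in> word_ball n"
  by (auto simp: word_ball_def)

definition RN :: "letter list \<Rightarrow> 'a \<times> (nat \<Rightarrow> letter) \<Rightarrow> real"
  where "RN g p = enn2real (RN_deriv P (distr P P (act g)) p)"

definition orbit_sum :: "nat \<Rightarrow> ('a \<times> (nat \<Rightarrow> letter) \<Rightarrow> real) \<Rightarrow> 'a \<times> (nat \<Rightarrow> letter) \<Rightarrow> real"
  where "orbit_sum n k p = (\<Sum>g\<in>{g \<in> horosphere r (snd p). length g \<le> 2 * n}. T_hat r M \<phi> g k p)"

definition class_sum :: "nat \<Rightarrow> ('a \<times> (nat \<Rightarrow> letter) \<Rightarrow> real) \<Rightarrow> 'a \<times> (nat \<Rightarrow> letter) \<Rightarrow> real"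
  where "class_sum n \<psi> p = (\<Sum>g\<in>{g \<in> word_ball n. busemann g (snd p) = 0}. \<psi> (act g p))"

lemma horosphere_word_ball:
  "{g \<in> horosphere r \<xi>. length g \<le> 2 * n} = {g \<in> word_ball n. busemann (inv_word g) \<xi> = 0}"
  by (auto simp: horosphere_eq[OF r] word_ball_def)

lemma T_hat_eq: "g \<in> reduced_words r \<Longrightarrow> T_hat r M \<phi> g k p = RN g p * k (act (inv_word g) p)"
  by (simp add: T_hat_def inv_free_grp RN_def)

text \<open>Both sides are integrals of \<open>f\<close> against the image of \<open>P\<close> under
  \<open>g\<close>. In this way the weights of \<open>T_hat\<close> disappear under the
  integral.\<close>

lemma RN_change_of_variables:
  assumes g: "g \<in> reduced_words r" and [measurable]: "f \<in> borel_measurable P"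
  shows "integrable P (\<lambda>p. RN g p * f p) \<longleftrightarrow> integrable P (\<lambda>p. f (act g p))"
    and "(\<integral>p. RN g p * f p \<partial>P) = (\<integral>p. f (act g p) \<partial>P)"
proof -
  note ac = sigma_finite_distr_act[OF g] absolutely_continuous_act[OF g]
  note [measurable] = measurable_act[OF g]
  show "integrable P (\<lambda>p. RN g p * f p) \<longleftrightarrow> integrable P (\<lambda>p. f (act g p))"
    unfolding RN_def using P.RN_deriv_integrable[OF ac, of f] by (simp add: integrable_distr_eq)
  show "(\<integral>p. RN g p * f p \<partial>P) = (\<integral>p. f (act g p) \<partial>P)"
    unfolding RN_def using P.RN_deriv_integral[OF ac, of f] by (simp add: integral_distr)
qed

lemma measurable_RN [measurable]: "RN g \<in> borel_measurable P"
  unfolding RN_def[abs_def] by measurable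

lemma RN_nonneg: "0 \<le> RN g p"
  by (simp add: RN_def)

lemma measurable_busemann_snd [measurable]:
  "g \<in> reduced_words r \<Longrightarrow> (\<lambda>p. busemann g (snd p)) \<in> P \<rightarrow>\<^sub>M count_space UNIV"
  by (rule measurable_compose[OF measurable_snd_P measurable_busemann]) (simp add: reduced_words_def)

text \<open>The horosphere depends on the point. Summation over a fixed finite set, with an
  indicator in each term, allows measurability and integrals to be treated one \<open>g\<close> at a
  time.\<close>

lemma orbit_sum_eq:
  "orbit_sum n k p =
    (\<Sum>g\<in>word_ball n. RN g p * (of_bool (busemann (inv_word g) (snd p) = 0) * k (act (inv_word g) p)))"
proof -
  have "orbit_sum n k p = (\<Sum>g\<in>{g \<in> word_ball n. busemann (inv_word g) (snd p) = 0}. T_hat r M \<phi> g k p)"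
    by (simp add: orbit_sum_def horosphere_word_ball)
  also have "\<dots> = (\<Sum>g\<in>word_ball n. RN g p *
      (of_bool (busemann (inv_word g) (snd p) = 0) * k (act (inv_word g) p)))"
    by (intro sum.mono_neutral_cong_left) (auto simp: T_hat_eq word_ball_words)
  finally show ?thesis .
qed

lemma measurable_orbit_sum [measurable]:
  assumes [measurable]: "k \<in> borel_measurable P"
  shows "orbit_sum n k \<in> borel_measurable P"
proof -
  have "(\<lambda>p. \<Sum>g\<in>word_ball n. RN g p *
      (of_bool (busemann (inv_word g) (snd p) = 0) * k (act (inv_word g) p))) \<in> borel_measurable P"
  proof (rule borel_measurable_sum)
    fix g assume "g \<in> word_ball n"
    then have [measurable]: "inv_word g \<in> reduced_words r" by (simp add: word_ball_words)
    show "(\<lambda>p. RN g p * (of_bool (busemann (inv_word g) (snd p) = 0) * k (act (inv_word g) p)))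
        \<in> borel_measurable P"
      by measurable
  qed
  then show ?thesis by (simp add: orbit_sum_eq[abs_def])
qed

lemma class_sum_bound:
  assumes "\<And>p. \<bar>\<psi> p\<bar> \<le> 1"
  shows "\<bar>class_sum n \<psi> p\<bar> \<le> card (word_ball n)"
proof -
  have "\<bar>class_sum n \<psi> p\<bar> \<le> (\<Sum>g\<in>{g \<in> word_ball n. busemann g (snd p) = 0}. \<bar>\<psi> (act g p)\<bar>)"
    unfolding class_sum_def by (rule sum_abs)
  also have "\<dots> \<le> (\<Sum>g\<in>{g \<in> word_ball n. busemann g (snd p) = 0}. 1)"
    by (intro sum_mono assms)
  also have "\<dots> \<le> card (word_ball n)"
    by (simp add: card_mono)
  finally show ?thesis .
qed

lemma measurable_class_sum:
  assumes [measurable]: "\<psi> \<in> borel_measurable P"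
  shows "class_sum n \<psi> \<in> borel_measurable (fibre_algebra n)"
proof -
  define G where "G q = (\<Sum>s | s \<in> reduced_words r \<and> length s = n.
      if s = [] \<or> last s \<noteq> inv_letter (snd q 0) then \<psi> (act s q) else (0::real))" for q
  have [measurable]: "(\<lambda>q. snd q 0) \<in> P \<rightarrow>\<^sub>M count_space UNIV"
    by (rule measurable_compose[OF measurable_snd_P measurable_coordinate])
  have "G \<in> borel_measurable P"
    unfolding G_def
  proof (rule borel_measurable_sum)
    fix s assume "s \<in> {s. s \<in> reduced_words r \<and> length s = n}"
    then have [measurable]: "s \<in> reduced_words r" by simp
    have [measurable]: "Measurable.pred P (\<lambda>q. s = [] \<or> last s \<noteq> inv_letter (snd q 0))"
      by (rule measurable_compose[OF \<open>(\<lambda>q. snd q 0) \<in> _\<close>]) simp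
    show "(\<lambda>q. if s = [] \<or> last s \<noteq> inv_letter (snd q 0) then \<psi> (act s q) else 0) \<in> borel_measurable P"
      by measurable
  qed
  then have "(\<lambda>p. G (proj n p)) \<in> borel_measurable (fibre_algebra n)"
    unfolding fibre_algebra_def
    by (rule measurable_compose[OF measurable_vimage_algebra1[OF proj_Pi]])
  moreover have "class_sum n \<psi> p = G (proj n p)" if "p \<in> space P" for p
    using sum_horospherical[OF that, where f = \<psi> and n = n]
    by (simp add: class_sum_def G_def word_ball_def conj_assoc)
  ultimately show ?thesis
    by (subst measurable_cong) (auto simp: fibre_algebra_def)
qed

text \<open>The transpose of the operator \<^const>\<open>orbit_sum\<close> sums over classes without weights, hence takes
  values in functions measurable with respect to the fibre algebra.\<close>

lemma orbit_sum_duality: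
  assumes k: "integrable P k" and \<psi> [measurable]: "\<psi> \<in> borel_measurable P" "\<And>p. \<bar>\<psi> p\<bar> \<le> 1"
  shows "integrable P (\<lambda>p. \<psi> p * orbit_sum n k p)"
    and "(\<integral>p. \<psi> p * orbit_sum n k p \<partial>P) = (\<integral>p. k p * class_sum n \<psi> p \<partial>P)"
proof -
  note [measurable] = borel_measurable_integrable[OF k]
  define f where "f g p = of_bool (busemann (inv_word g) (snd p) = 0) * k (act (inv_word g) p) * \<psi> p"
    for g p
  have eq: "\<psi> p * orbit_sum n k p = (\<Sum>g\<in>word_ball n. RN g p * f g p)" for p
    by (simp add: orbit_sum_eq f_def sum_distrib_left mult_ac)
  \<comment> \<open>Under the substitution of \<open>act g p\<close> for \<open>p\<close> the
    argument of \<open>k\<close> returns to \<open>p\<close>, and the cocycle of the inverse of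
    \<open>g\<close> becomes minus that of \<open>g\<close>. The condition thus turns into the one
    that defines \<open>class_sum\<close>.\<close>
  have f_act: "f g (act g p) = k p * (of_bool (busemann g (snd p) = 0) * \<psi> (act g p))"
    if "g \<in> word_ball n" "p \<in> space P" for g p
    using that word_ball_words(1)[of g n]
    by (simp add: f_def act_inv_word snd_act busemann_inv_word mem_space_P)
  have int: "integrable P (\<lambda>p. RN g p * f g p) \<and>
      (\<integral>p. RN g p * f g p \<partial>P) = (\<integral>p. k p * (of_bool (busemann g (snd p) = 0) * \<psi> (act g p)) \<partial>P) \<and>
      integrable P (\<lambda>p. k p * (of_bool (busemann g (snd p) = 0) * \<psi> (act g p)))"
    if g: "g \<in> word_ball n" for g
  proof -
    have [measurable]: "g \<in> reduced_words r" "inv_word g \<in> reduced_words r"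
      using g by (simp_all add: word_ball_words)
    have [measurable]: "f g \<in> borel_measurable P" unfolding f_def by measurable
    have i: "integrable P (\<lambda>p. k p * (of_bool (busemann g (snd p) = 0) * \<psi> (act g p)))"
    proof (rule Bochner_Integration.integrable_bound[OF k])
      show "AE p in P. norm (k p * (of_bool (busemann g (snd p) = 0) * \<psi> (act g p))) \<le> norm (k p)"
        using \<psi>(2) by (intro AE_I2) (auto simp: abs_mult mult_left_le)
    qed measurable
    moreover have "integrable P (\<lambda>p. f g (act g p)) \<longleftrightarrow>
        integrable P (\<lambda>p. k p * (of_bool (busemann g (snd p) = 0) * \<psi> (act g p)))"
      by (intro Bochner_Integration.integrable_cong) (use f_act g in auto)
    moreover have "(\<integral>p. f g (act g p) \<partial>P) =
        (\<integral>p. k p * (of_bool (busemann g (snd p) = 0) * \<psi> (act g p)) \<partial>P)"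
      by (intro Bochner_Integration.integral_cong) (use f_act g in auto)
    moreover note RN_change_of_variables[OF word_ball_words(1)[OF g] \<open>f g \<in> _\<close>]
    ultimately show ?thesis by simp
  qed
  show "integrable P (\<lambda>p. \<psi> p * orbit_sum n k p)"
    unfolding eq using int by (intro Bochner_Integration.integrable_sum) blast
  have "(\<integral>p. \<psi> p * orbit_sum n k p \<partial>P) = (\<Sum>g\<in>word_ball n. \<integral>p. RN g p * f g p \<partial>P)"
    unfolding eq using int by (intro Bochner_Integration.integral_sum) blast
  also have "\<dots> = (\<Sum>g\<in>word_ball n. \<integral>p. k p * (of_bool (busemann g (snd p) = 0) * \<psi> (act g p)) \<partial>P)"
    using int by (intro sum.cong) auto
  also have "\<dots> = (\<integral>p. (\<Sum>g\<in>word_ball n. k p * (of_bool (busemann g (snd p) = 0) * \<psi> (act g p))) \<partial>P)"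
    using int by (intro Bochner_Integration.integral_sum[symmetric]) blast
  also have "(\<lambda>p. \<Sum>g\<in>word_ball n. k p * (of_bool (busemann g (snd p) = 0) * \<psi> (act g p))) =
      (\<lambda>p. k p * class_sum n \<psi> p)"
    unfolding class_sum_def sum_distrib_left[symmetric]
    by (intro ext arg_cong2[where f = "(*)"] refl sum.mono_neutral_cong_right) auto
  finally show "(\<integral>p. \<psi> p * orbit_sum n k p \<partial>P) = (\<integral>p. k p * class_sum n \<psi> p \<partial>P)" .
qed

text \<open>With the sign of the orbit sum as test function, the dual pairing is the L^1 norm of the
  orbit sum.\<close>

lemma orbit_sum_eq_0:
  assumes k: "integrable P k"
    and 0: "\<And>\<psi>. \<psi> \<in> borel_measurable P \<Longrightarrow> (\<And>p. \<bar>\<psi> p\<bar> \<le> 1) \<Longrightarrow> (\<integral>p. k p * class_sum n \<psi> p \<partial>P) = 0"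
  shows "AE p in P. orbit_sum n k p = 0"
proof -
  note [measurable] = borel_measurable_integrable[OF k]
  let ?\<psi> = "\<lambda>p. sgn (orbit_sum n k p)"
  have \<psi>: "?\<psi> \<in> borel_measurable P" by measurable
  have \<psi>1: "\<bar>?\<psi> p\<bar> \<le> 1" for p by (simp add: sgn_if)
  have abs: "?\<psi> p * orbit_sum n k p = \<bar>orbit_sum n k p\<bar>" for p by (simp add: abs_sgn mult.commute)
  have "integrable P (\<lambda>p. \<bar>orbit_sum n k p\<bar>)" "(\<integral>p. \<bar>orbit_sum n k p\<bar> \<partial>P) = 0"
    using orbit_sum_duality[OF k \<psi> \<psi>1, of n] 0[OF \<psi> \<psi>1] by (simp_all add: abs)
  then show ?thesis by (subst (asm) integral_nonneg_eq_0_iff_AE) auto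
qed

lemma RN_Nil: "AE p in P. RN [] p = 1"
proof -
  have "distr P P (act []) = density P (\<lambda>_. 1)"
    by (simp add: density_1 act_Nil distr_id cong: distr_cong)
  then have "AE p in P. 1 = RN_deriv P (distr P P (act [])) p"
    by (intro P.RN_deriv_unique) auto
  then show ?thesis by eventually_elim (simp add: RN_def flip: enn2real_1)
qed

text \<open>The identity lies in every horosphere and contributes \<open>v p\<close> itself, its
  derivative being 1; the other terms are nonnegative. This permits the division by the denominator
  of the ratio.\<close>

lemma orbit_sum_pos:
  assumes v: "AE p in P. 0 < v p"
  shows "AE p in P. 0 < orbit_sum n v p"
proof -
  have "AE p in P. \<forall>g\<in>word_ball n. 0 < v (act (inv_word g) p)"
  proof (rule AE_finite_allI)
    fix g assume "g \<in> word_ball n"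
    then have "inv_word g \<in> reduced_words r" by (simp add: word_ball_words)
    from AE_distr_absolutely_continuous[OF measurable_act[OF this] absolutely_continuous_act[OF this] v]
    show "AE p in P. 0 < v (act (inv_word g) p)" .
  qed simp
  with RN_Nil v AE_space show ?thesis
  proof eventually_elim
    case (elim p)
    have B: "[] \<in> word_ball n" by (simp add: word_ball_def)
    have "0 < RN [] p * (of_bool (busemann (inv_word []) (snd p) = 0) * v (act (inv_word []) p))"
      using elim by (simp add: act_Nil)
    then show ?case
      unfolding orbit_sum_eq using elim
      by (intro sum_pos2[OF finite_word_ball B]) (simp_all add: RN_nonneg less_imp_le)
  qed
qed

text \<open>All points at which the sum evaluates its argument lie in the fibre of
  \<open>proj n\<close> through \<open>p\<close>, where \<open>h\<close> is constant.\<close>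

lemma orbit_sum_invariant_factor:
  assumes h: "h \<in> borel_measurable (fibre_algebra n)" and p: "p \<in> space P"
  shows "orbit_sum n (\<lambda>q. u q - v q * h q) p = orbit_sum n u p - orbit_sum n v p * h p"
proof -
  have eq: "h (act (inv_word g) p) = h p"
    if "g \<in> word_ball n" "busemann (inv_word g) (snd p) = 0" for g
  proof (rule fibre_algebra_measurable_eq[OF h])
    show "proj n (act (inv_word g) p) = proj n p"
      by (rule proj_act) (use that p in \<open>auto simp: word_ball_def\<close>)
  qed (use that p in \<open>auto simp: word_ball_words act_space\<close>)
  show ?thesis
    unfolding orbit_sum_eq sum_distrib_right sum_subtractf[symmetric]
    by (intro sum.cong refl) (auto simp: algebra_simps eq)
qed


section \<open>The finite measure with density \<open>v\<close>, and the limit of the ratios\<close>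

definition weighted :: "('a \<times> (nat \<Rightarrow> letter) \<Rightarrow> real) \<Rightarrow> ('a \<times> (nat \<Rightarrow> letter)) measure"
  where "weighted v = density P (\<lambda>p. ennreal (v p))"

lemma decreasing_filtration_weighted:
  assumes v: "integrable P v" "AE p in P. 0 < v p"
  shows "decreasing_filtration (weighted v) fibre_algebra"
proof -
  note [measurable] = borel_measurable_integrable[OF v(1)]
  have v0: "AE p in P. 0 \<le> v p" using v(2) by eventually_elim simp
  have "emeasure (weighted v) (space (weighted v)) = (\<integral>\<^sup>+p. ennreal (v p) \<partial>P)"
    by (simp add: weighted_def emeasure_density cong: nn_integral_cong)
  also have "\<dots> = ennreal (\<integral>p. v p \<partial>P)" using v(1) v0 by (rule nn_integral_eq_integral)
  finally interpret finite_measure "weighted v" by (intro finite_measureI) simp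
  show ?thesis
    using subalgebra_fibre_algebra subalgebra_fibre_algebra_Suc
    by unfold_locales (auto simp: subalgebra_def weighted_def)
qed

lemma AE_weighted:
  assumes v: "v \<in> borel_measurable P" "AE p in P. 0 < v p"
  shows "(AE p in weighted v. Q p) \<longleftrightarrow> (AE p in P. Q p)"
proof -
  have "(AE p in weighted v. Q p) \<longleftrightarrow> (AE p in P. 0 < v p \<longrightarrow> Q p)"
    unfolding weighted_def using v(1) by (subst AE_density) auto
  also have "\<dots> \<longleftrightarrow> (AE p in P. Q p)"
    using v(2) by (intro iffI) (auto elim: eventually_elim2 eventually_mono)
  finally show ?thesis .
qed

lemma weighted_integral:
  fixes f :: "'a \<times> (nat \<Rightarrow> letter) \<Rightarrow> real"
  assumes "v \<in> borel_measurable P" "AE p in P. 0 < v p" "f \<in> borel_measurable P"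
  shows "integrable (weighted v) f \<longleftrightarrow> integrable P (\<lambda>p. v p * f p)"
    and "(\<integral>p. f p \<partial>weighted v) = (\<integral>p. v p * f p \<partial>P)"
proof -
  have "AE p in P. 0 \<le> v p" using assms(2) by eventually_elim simp
  then show "integrable (weighted v) f \<longleftrightarrow> integrable P (\<lambda>p. v p * f p)"
    "(\<integral>p. f p \<partial>weighted v) = (\<integral>p. v p * f p \<partial>P)"
    using assms by (simp_all add: weighted_def integrable_density integral_density)
qed

lemma weighted_integral_quotient:
  fixes u c :: "'a \<times> (nat \<Rightarrow> letter) \<Rightarrow> real"
  assumes [measurable]: "v \<in> borel_measurable P" "u \<in> borel_measurable P" "c \<in> borel_measurable P"
    and v: "AE p in P. 0 < v p"
  shows "integrable (weighted v) (\<lambda>p. c p * (u p / v p)) \<longleftrightarrow> integrable P (\<lambda>p. u p * c p)"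
    and "(\<integral>p. c p * (u p / v p) \<partial>weighted v) = (\<integral>p. u p * c p \<partial>P)"
proof -
  have eq: "AE p in P. v p * (c p * (u p / v p)) = u p * c p"
    using v by eventually_elim simp
  have m: "(\<lambda>p. c p * (u p / v p)) \<in> borel_measurable P" by measurable
  show "integrable (weighted v) (\<lambda>p. c p * (u p / v p)) \<longleftrightarrow> integrable P (\<lambda>p. u p * c p)"
    unfolding weighted_integral(1)[OF assms(1) v m] by (rule integrable_cong_AE[OF _ _ eq]) measurable
  show "(\<integral>p. c p * (u p / v p) \<partial>weighted v) = (\<integral>p. u p * c p \<partial>P)"
    unfolding weighted_integral(2)[OF assms(1) v m] by (rule integral_cong_AE[OF _ _ eq]) measurable
qed

text \<open>Class sums are bounded and fibre-measurable, so by the defining property of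
  \<open>h\<close> they integrate \<open>u - v h\<close> to 0. Duality then makes the orbit sum of
  \<open>u - v h\<close> vanish; taking \<open>h\<close> out of it leaves an equation that is
  divided by the positive orbit sum of \<open>v\<close>.\<close>

theorem ratio_eq_cond_exp:
  assumes u: "integrable P u" and v: "integrable P v" "AE p in P. 0 < v p"
  shows "AE p in P. ratio r M \<phi> (2 * n) u v p =
    real_cond_exp (weighted v) (fibre_algebra n) (\<lambda>p. u p / v p) p"
proof -
  note [measurable] = borel_measurable_integrable[OF u] borel_measurable_integrable[OF v(1)]
  interpret decreasing_filtration "weighted v" fibre_algebra
    by (rule decreasing_filtration_weighted[OF v])
  let ?f = "\<lambda>p. u p / v p"
  define h where "h = real_cond_exp (weighted v) (fibre_algebra n) ?f"
  have hF: "h \<in> borel_measurable (fibre_algebra n)" unfolding h_def by simp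
  then have [measurable]: "h \<in> borel_measurable P"
    by (rule measurable_from_subalg[OF subalgebra_fibre_algebra])
  have fW: "?f \<in> borel_measurable (weighted v)" by (simp add: weighted_def)
  have "integrable (weighted v) ?f"
    using weighted_integral_quotient(1)[of v u "\<lambda>_. 1"] u v(2) by simp
  then have "integrable (weighted v) h"
    unfolding h_def by (rule subalg.real_cond_exp_int(1))
  then have vh: "integrable P (\<lambda>p. v p * h p)"
    using weighted_integral(1)[OF _ v(2)] by simp
  let ?k = "\<lambda>p. u p - v p * h p"
  have k: "integrable P ?k" using u vh by simp
  have "AE p in P. orbit_sum n ?k p = 0"
  proof (rule orbit_sum_eq_0[OF k])
    fix \<psi> :: "'a \<times> (nat \<Rightarrow> letter) \<Rightarrow> real"
    assume \<psi> [measurable]: "\<psi> \<in> borel_measurable P" and b: "\<And>p. \<bar>\<psi> p\<bar> \<le> 1"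
    let ?c = "class_sum n \<psi>"
    have cF: "?c \<in> borel_measurable (fibre_algebra n)" by (rule measurable_class_sum) fact
    then have [measurable]: "?c \<in> borel_measurable P"
      by (rule measurable_from_subalg[OF subalgebra_fibre_algebra])
    have bound: "integrable P (\<lambda>p. g p * ?c p)" if "integrable P g" for g
    proof (rule Bochner_Integration.integrable_bound)
      show "integrable P (\<lambda>p. g p * real (card (word_ball n)))" using that by simp
      show "AE p in P. norm (g p * ?c p) \<le> norm (g p * real (card (word_ball n)))"
        using class_sum_bound[of \<psi> n] b by (intro AE_I2) (auto simp: abs_mult intro!: mult_left_mono)
    qed (use borel_measurable_integrable[OF that] in measurable)
    have cf: "integrable (weighted v) (\<lambda>p. ?c p * ?f p)"
      using weighted_integral_quotient(1)[of v u ?c] bound[OF u] v(2) by simp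
    have "(\<integral>p. u p * ?c p \<partial>P) = (\<integral>p. ?c p * ?f p \<partial>weighted v)"
      using weighted_integral_quotient(2)[of v u ?c] v(2) by simp
    also have "\<dots> = (\<integral>p. ?c p * h p \<partial>weighted v)"
      unfolding h_def by (rule subalg.real_cond_exp_intg(2)[OF cf cF fW, symmetric])
    also have "\<dots> = (\<integral>p. v p * h p * ?c p \<partial>P)"
      using weighted_integral(2)[OF _ v(2), of "\<lambda>p. ?c p * h p"] by (simp add: mult_ac)
    finally show "(\<integral>p. ?k p * ?c p \<partial>P) = 0"
      using bound[OF u] bound[OF vh] by (simp add: left_diff_distrib)
  qed
  with orbit_sum_pos[OF v(2), of n] AE_space show ?thesis
  proof eventually_elim
    case (elim p)
    then have "orbit_sum n u p = orbit_sum n v p * h p"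
      using orbit_sum_invariant_factor[OF hF elim(2), of u v] by simp
    then show ?case
      using elim(1) by (simp add: ratio_def h_def flip: orbit_sum_def)
  qed
qed

theorem ratio_ergodic:
  assumes u: "integrable P u" and v: "integrable P v" "AE p in P. 0 < v p"
  shows "\<exists>w \<in> borel_measurable P.
      (AE p in P. (\<lambda>n. ratio r M \<phi> (2 * n) u v p) \<longlonglongrightarrow> w p) \<and>
      invariant_mod_null P (R0 r M \<phi>) w \<and>
      (ergodic_relation P (R0 r M \<phi>) \<longrightarrow>
        (AE p in P. w p = integral\<^sup>L P u / integral\<^sup>L P v))"
proof -
  note [measurable] = borel_measurable_integrable[OF u] borel_measurable_integrable[OF v(1)]
  interpret decreasing_filtration "weighted v" fibre_algebra
    by (rule decreasing_filtration_weighted[OF v])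
  note AEw = AE_weighted[OF borel_measurable_integrable[OF v(1)] v(2)]
  let ?f = "\<lambda>p. u p / v p"
  define w where "w p = lim (\<lambda>n. E n ?f p)" for p
  have Em [measurable]: "E n ?f \<in> borel_measurable P" for n
    by (rule measurable_from_subalg[OF subalgebra_fibre_algebra borel_measurable_cond_exp])
  have w [measurable]: "w \<in> borel_measurable P"
    unfolding w_def by (rule borel_measurable_lim_metric[OF Em])
  have fi: "integrable (weighted v) ?f"
    using weighted_integral_quotient(1)[of v u "\<lambda>_. 1"] u v(2) by simp
  have lim: "AE p in P. (\<lambda>n. E n ?f p) \<longlonglongrightarrow> w p"
    using reverse_martingale_convergence[OF fi] unfolding AEw w_def .
  have "AE p in P. \<forall>n. ratio r M \<phi> (2 * n) u v p = E n ?f p"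
    unfolding AE_all_countable using ratio_eq_cond_exp[OF u v] by blast
  with lim have conv: "AE p in P. (\<lambda>n. ratio r M \<phi> (2 * n) u v p) \<longlonglongrightarrow> w p"
    by eventually_elim simp
  \<comment> \<open>From index \<open>length g\<close> on, \<open>p\<close> and \<open>q\<close>
    share a fibre, so the two sequences eventually agree. Then \<open>lim\<close> returns the same
    value for both, even where it is not a limit, and invariance holds with an empty exceptional
    set.\<close>
  have w_eq: "w p = w q" if "(p, q) \<in> R0 r M \<phi>" for p q
  proof -
    obtain g where p: "p \<in> space P" and g: "g \<in> reduced_words r" "busemann (inv_word g) (snd p) = 0"
      and q: "q = act (inv_word g) p"
      using \<open>(p, q) \<in> R0 r M \<phi>\<close> by (auto simp: R0_def horosphere_eq[OF r] inv_free_grp)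
    have "E n ?f q = E n ?f p" if "length g \<le> n" for n
    proof (rule fibre_algebra_measurable_eq)
      show "E n ?f \<in> borel_measurable (fibre_algebra n)" by simp
      show "proj n q = proj n p"
        unfolding q by (rule proj_act[OF p]) (use g that in auto)
    qed (use p q g act_space in auto)
    then have "\<forall>\<^sub>F n in sequentially. E n ?f q = E n ?f p"
      unfolding eventually_sequentially by blast
    then have "(\<lambda>n. E n ?f q) \<longlonglongrightarrow> l \<longleftrightarrow> (\<lambda>n. E n ?f p) \<longlonglongrightarrow> l" for l
      by (rule tendsto_cong)
    then show ?thesis by (simp add: w_def lim_def)
  qed
  let ?c = "integral\<^sup>L P u / integral\<^sup>L P v"
  have "AE p in P. w p = ?c" if erg: "ergodic_relation P (R0 r M \<phi>)"
  proof -
    have wi: "integrable (weighted v) w" "(\<integral>p. w p \<partial>weighted v) = (\<integral>p. u p \<partial>P)"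
      using reverse_martingale_integral[OF fi, of w] lim AEw
        weighted_integral_quotient(2)[of v u "\<lambda>_. 1"] v(2) by (auto simp: weighted_def)
    have iw: "integrable P (\<lambda>p. v p * w p)" "(\<integral>p. v p * w p \<partial>P) = (\<integral>p. u p \<partial>P)"
      using wi weighted_integral[OF _ v(2) w] by simp_all
    have c: "?c * (\<integral>p. v p \<partial>P) = (\<integral>p. u p \<partial>P)"
    \<comment> \<open>\<open>M\<close> may be the zero measure. As \<open>v\<close> is positive
      almost everywhere, a zero integral means that everything is null; the quotient is then 0 by
      the convention on division, and the integral of \<open>u\<close> is 0 as well.\<close>
    proof (cases "(\<integral>p. v p \<partial>P) = 0")
      case True
      have "AE p in P. v p = 0"
        using True v(2) by (subst (asm) integral_nonneg_eq_0_iff_AE[OF v(1)])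
          (auto elim: eventually_mono)
      with v(2) have "AE p in P. u p = 0" by eventually_elim simp
      then have "(\<integral>p. u p \<partial>P) = 0" by (rule integral_eq_zero_AE)
      then show ?thesis by simp
    qed simp
    let ?d = "\<lambda>p. v p * (w p - ?c)"
    have d: "integrable P ?d" "(\<integral>p. ?d p \<partial>P) = 0"
      using iw v(1) c by (simp_all add: right_diff_distrib mult.commute)
    \<comment> \<open>One level set suffices, because the mean of \<open>w\<close> under the
      weighted measure is already known to be \<open>?c\<close>. Ergodicity puts \<open>w\<close>
      almost everywhere on one side of \<open>?c\<close>, so \<open>?d\<close> has constant sign and
      integral 0, hence vanishes.\<close>
    define A where "A = {p \<in> space P. ?c < w p}"
    have A: "A \<in> sets P" unfolding A_def by measurable
    have "invariant_mod_null P (R0 r M \<phi>) (indicator A)"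
      unfolding invariant_mod_null_def
      by (intro bexI[of _ "{}"]) (auto simp: A_def indicator_def dest: w_eq)
    then consider "A \<in> null_sets P" | "space P - A \<in> null_sets P"
      using erg A unfolding ergodic_relation_def by blast
    then have "AE p in P. ?d p = 0"
    proof cases
      case 1
      from v(2) AE_not_in[OF 1] AE_space have "AE p in P. 0 \<le> - ?d p"
        by eventually_elim (auto simp: A_def mult_le_0_iff)
      then have "AE p in P. - ?d p = 0"
        using d by (subst integral_nonneg_eq_0_iff_AE[symmetric]) auto
      then show ?thesis by eventually_elim simp
    next
      case 2
      from v(2) AE_not_in[OF 2] AE_space have "AE p in P. 0 \<le> ?d p"
        by eventually_elim (auto simp: A_def)
      then show ?thesis
        using d by (subst integral_nonneg_eq_0_iff_AE[symmetric]) auto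
    qed
    with v(2) show ?thesis by eventually_elim simp
  qed
  moreover have "invariant_mod_null P (R0 r M \<phi>) w"
    unfolding invariant_mod_null_def by (intro bexI[of _ "{}"]) (auto dest: w_eq)
  ultimately show ?thesis using w conv by blast
qed

end

theorem theorem1p1:
  fixes r :: nat
    and M :: "'a measure"
    and \<phi> :: "letter list \<Rightarrow> 'a \<Rightarrow> 'a"
    and u v :: "'a \<times> (nat \<Rightarrow> letter) \<Rightarrow> real"
  assumes "r \<ge> 2"
    and "standard_borel_space M"
    and "sigma_finite_measure M"
    and "nonsingular_action (free_grp r) M \<phi>"
    and "integrable (prod_measure r M) u"
    and "integrable (prod_measure r M) v"
    and "AE p in prod_measure r M. v p > 0"
  shows "\<exists>w \<in> borel_measurable (prod_measure r M).
      (AE p in prod_measure r M. (\<lambda>n. ratio r M \<phi> (2 * n) u v p) \<longlonglongrightarrow> w p) \<and>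
      invariant_mod_null (prod_measure r M) (R0 r M \<phi>) w \<and>
      (ergodic_relation (prod_measure r M) (R0 r M \<phi>) \<longrightarrow>
        (AE p in prod_measure r M.
           w p = integral\<^sup>L (prod_measure r M) u / integral\<^sup>L (prod_measure r M) v))"
  using boundary_measure_cases[of r]
proof
  assume "\<forall>s\<in>reduced_words r - {[]}.
    emeasure (boundary_measure r) (cylinder r s) = ennreal (cylinder_mass r s)"
  then interpret boundary_space r
    using assms(1) by (intro boundary_space.intro) blast+
  interpret horospherical_action r M \<phi>
    using assms(3,4) by (intro horospherical_action.intro horospherical_action_axioms.intro boundary_space_axioms)
  show ?thesis using assms(5-7) by (rule ratio_ergodic)
next
  assume 0: "emeasure (boundary_measure r) = (\<lambda>_. 0)"
  interpret finite_measure "boundary_measure r" by (rule finite_measureI) (simp add: 0)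
  have "emeasure (prod_measure r M) (space (prod_measure r M)) = 0"
    by (simp add: prod_measure_def space_pair_measure emeasure_pair_measure_Times 0
        del: space_boundary_measure)
  then have "AE p in prod_measure r M. Q p" for Q
    by (intro AE_I[of _ _ "space (prod_measure r M)"]) auto
  then show ?thesis
    by (intro bexI[of _ "\<lambda>_. 0"]) (auto simp: invariant_mod_null_def)
qed

end
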